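(* Let $K$ be a field, let $\Delta$ be a simplicial complex on the vertex set $[n]$, let $i\in[n]$, and assume $\dim_K T^1(\Delta)_{-\mathbf e_i}=k$. Then there exists a simplicial complex $\widetilde\Delta$ on the vertex set $([n]\setminus\{i\})\cup\{v_0,\ldots,v_k\}$ (where $v_0,\ldots,v_k$ are pairwise distinct new vertices) such that $I_{\widetilde\Delta}$ is obtained from $I_\Delta$ by $k$ successive separations for the variable $x_i$. Moreover, $T^1(\widetilde\Delta)_{-\mathbf b}=0$ for every vector $\mathbf b$ with non-negative integer entries, indexed by the vertex set of $\widetilde\Delta$, whose support satisfies $\mathrm{supp}\,\mathbf b\subseteq\{v_0,\ldots,v_k\}$.
   Context: A simplicial complex on a finite vertex set $V$ is a collection of subsets of $V$ closed under taking subsets and containing $\emptyset$; not every $\{v\}$, $v \in V$, need be a face. Given a field $K$ and $V=[n]$, let $S=K[x_1,\ldots,x_n]$; the Stanley--Reisner ideal $I_\Delta\subseteq S$ is generated by the monomials $x_N=\prod_{i\in N}x_i$, $N\subseteq[n]$, $N\notin\Delta$ (similarly for other vertex sets), and $K[\Delta]=S/I_\Delta$. For an ideal $I\subseteq S$, $T^1(S/I)$ is the cokernel of $\delta^*:\mathrm{Der}_K(S)\to \mathrm{Hom}_S(I,S/I)$, $\delta^*(\partial)(f)=\partial f+I$. For a monomial ideal it is $\mathbb Z^n$-graded (with $\deg x_i=\mathbf e_i$, the $i$th canonical basis vector). Put $T^1(\Delta)=T^1(K[\Delta])$. The support of $\mathbf b$ is the set of indices at which $\mathbf b$ is nonzero.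 Separation: for a squarefree monomial ideal $I$ in a polynomial ring $S$ and a new indeterminate $y$, a monomial ideal $J\subseteq S[y]$ is a separation of $I$ for the variable $x_i$ if (i) $I$ is the image of $J$ under the $K$-algebra homomorphism $S[y]\to S$ sending $y\mapsto x_i$ and fixing all variables of $S$; (ii) $x_i$ divides some minimal monomial generator of $J$ and $y$ divides some minimal monomial generator of $J$; (iii) $y-x_i$ is a non-zero divisor on $S[y]/J$. "$I_{\widetilde\Delta}$ is obtained from $I_\Delta$ by $k$ successive separations for $x_i$" means: there are squarefree monomial ideals $I_0=I_\Delta\subseteq S$, $I_j\subseteq S[y_1,\ldots,y_j]$ $(1\le j\le k)$ such that $I_j$ is a separation of $I_{j-1}$ for the variable $x_i$ with new variable $y_j$, and $I_{\widetilde\Delta}$ is $I_k$ after letting the variable $x_i$ correspond to the vertex $v_0$ and $y_j$ to the vertex $v_j$. *)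

theory Defs
  imports "HOL-Library.Poly_Mapping" "HOL-Algebra.QuotRing" "Jordan_Normal_Form.VS_Connect"
begin

type_synonym ('v, 'a) mpoly = "('v \<Rightarrow>\<^sub>0 nat) \<Rightarrow>\<^sub>0 'a"

text \<open>The ambient type \<open>('v, 'a) mpoly\<close> has an indeterminate for every element of \<open>'v\<close>;
  \<open>K[x\<^sub>w | w \<in> V]\<close> is the subring of the polynomials that only involve variables indexed by \<open>V\<close>.\<close>

definition poly_ring :: "'v set \<Rightarrow> ('v, 'a::comm_ring_1) mpoly ring" where
  "poly_ring V = class_ring \<lparr>carrier := {p. \<forall>m\<in>Poly_Mapping.keys p. Poly_Mapping.keys m \<subseteq> V}\<rparr>"

definition Const :: "'a::comm_ring_1 \<Rightarrow> ('v, 'a) mpoly" where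
  "Const c = Poly_Mapping.single 0 c"

definition xpow :: "('v \<Rightarrow>\<^sub>0 nat) \<Rightarrow> ('v, 'a::comm_ring_1) mpoly" where
  "xpow m = Poly_Mapping.single m 1"

definition Var :: "'v \<Rightarrow> ('v, 'a::comm_ring_1) mpoly" where
  "Var w = xpow (Poly_Mapping.single w 1)"

text \<open>The \<open>K\<close>-algebra homomorphism with \<open>x\<^sub>w \<mapsto> x\<^bsub>\<rho> w\<^esub>\<close>.\<close>

definition rename_vars :: "('v \<Rightarrow> 'w) \<Rightarrow> ('v, 'a::comm_ring_1) mpoly \<Rightarrow> ('w, 'a) mpoly" where
  "rename_vars \<rho> p =
     (\<Sum>m\<in>Poly_Mapping.keys p. Const (Poly_Mapping.lookup p m) *
        (\<Prod>w\<in>Poly_Mapping.keys m. Var (\<rho> w) ^ Poly_Mapping.lookup m w))"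

definition monomial_ideal :: "'v set \<Rightarrow> ('v, 'a::comm_ring_1) mpoly set \<Rightarrow> bool" where
  "monomial_ideal V J \<longleftrightarrow>
     (\<exists>M. (\<forall>m\<in>M. Poly_Mapping.keys m \<subseteq> V) \<and> J = Idl\<^bsub>poly_ring V\<^esub> (xpow ` M))"

definition squarefree_monomial_ideal :: "'v set \<Rightarrow> ('v, 'a::comm_ring_1) mpoly set \<Rightarrow> bool" where
  "squarefree_monomial_ideal V J \<longleftrightarrow>
     (\<exists>M. (\<forall>m\<in>M. Poly_Mapping.keys m \<subseteq> V \<and> (\<forall>w. Poly_Mapping.lookup m w \<le> 1)) \<and>
        J = Idl\<^bsub>poly_ring V\<^esub> (xpow ` M))"

definition minimal_generators :: "('v, 'a::comm_ring_1) mpoly set \<Rightarrow> ('v, 'a) mpoly set" where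
  "minimal_generators J =
     {f \<in> J \<inter> range xpow. \<forall>g \<in> J \<inter> range xpow. g dvd f \<longrightarrow> g = f}"

definition simplicial_complex :: "'v set \<Rightarrow> 'v set set \<Rightarrow> bool" where
  "simplicial_complex V \<Delta> \<longleftrightarrow>
     finite V \<and> \<Delta> \<subseteq> Pow V \<and> {} \<in> \<Delta> \<and> (\<forall>F\<in>\<Delta>. \<forall>G. G \<subseteq> F \<longrightarrow> G \<in> \<Delta>)"

text \<open>The argument \<open>K\<close> only carries the type of coefficients.\<close>

definition SR_ideal :: "'a::field itself \<Rightarrow> 'v set \<Rightarrow> 'v set set \<Rightarrow> ('v, 'a) mpoly set" where
  "SR_ideal K V \<Delta> = Idl\<^bsub>poly_ring V\<^esub> {\<Prod>w\<in>N. Var w | N. N \<subseteq> V \<and> N \<notin> \<Delta>}"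

text \<open>The elements of \<open>S/I\<close> are cosets, as in \<^theory>\<open>HOL-Algebra.QuotRing\<close>. All modules below
  are equipped with their structure of vector space over \<open>K\<close>.\<close>

definition Hom_quot ::
  "'v set \<Rightarrow> ('v, 'a::field) mpoly set \<Rightarrow> (('v, 'a) mpoly \<Rightarrow> ('v, 'a) mpoly set) set" where
  "Hom_quot V I = (let S = poly_ring V; Q = S Quot I in
     {\<phi> \<in> I \<rightarrow>\<^sub>E carrier Q.
        (\<forall>f\<in>I. \<forall>g\<in>I. \<phi> (f \<oplus>\<^bsub>S\<^esub> g) = \<phi> f \<oplus>\<^bsub>Q\<^esub> \<phi> g) \<and>
        (\<forall>s\<in>carrier S. \<forall>f\<in>I. \<phi> (s \<otimes>\<^bsub>S\<^esub> f) = (I +>\<^bsub>S\<^esub> s) \<otimes>\<^bsub>Q\<^esub> \<phi> f)})"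

text \<open>The multiplicative fields of the record are irrelevant for a module.\<close>

definition Hom_module ::
  "'v set \<Rightarrow> ('v, 'a::field) mpoly set \<Rightarrow> ('a, ('v, 'a) mpoly \<Rightarrow> ('v, 'a) mpoly set) module" where
  "Hom_module V I = (let S = poly_ring V; Q = S Quot I in
     \<lparr>carrier = Hom_quot V I, mult = undefined, one = undefined,
      zero = (\<lambda>f\<in>I. \<zero>\<^bsub>Q\<^esub>),
      add = (\<lambda>\<phi> \<psi>. \<lambda>f\<in>I. \<phi> f \<oplus>\<^bsub>Q\<^esub> \<psi> f),
      smult = (\<lambda>c \<phi>. \<lambda>f\<in>I. (I +>\<^bsub>S\<^esub> Const c) \<otimes>\<^bsub>Q\<^esub> \<phi> f)\<rparr>)"

definition derivations :: "'v set \<Rightarrow> (('v, 'a::field) mpoly \<Rightarrow> ('v, 'a) mpoly) set" where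
  "derivations V = (let S = poly_ring V in
     {D \<in> carrier S \<rightarrow>\<^sub>E carrier S.
        (\<forall>p\<in>carrier S. \<forall>q\<in>carrier S. D (p + q) = D p + D q) \<and>
        (\<forall>c. \<forall>p\<in>carrier S. D (Const c * p) = Const c * D p) \<and>
        (\<forall>p\<in>carrier S. \<forall>q\<in>carrier S. D (p * q) = p * D q + q * D p)})"

definition delta ::
  "'v set \<Rightarrow> ('v, 'a::field) mpoly set \<Rightarrow> (('v, 'a) mpoly \<Rightarrow> ('v, 'a) mpoly)
     \<Rightarrow> ('v, 'a) mpoly \<Rightarrow> ('v, 'a) mpoly set" where
  "delta V I D = (\<lambda>f\<in>I. I +>\<^bsub>poly_ring V\<^esub> D f)"

definition quot_module :: "('a, 'b) module \<Rightarrow> 'b set \<Rightarrow> ('a, 'b set) module" where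
  "quot_module M N =
     \<lparr>carrier = a_rcosets\<^bsub>M\<^esub> N, mult = undefined, one = undefined,
      zero = N, add = set_add M,
      smult = (\<lambda>c X. \<Union>x\<in>X. N +>\<^bsub>M\<^esub> (c \<odot>\<^bsub>M\<^esub> x))\<rparr>"

definition T1 ::
  "'v set \<Rightarrow> ('v, 'a::field) mpoly set \<Rightarrow> ('a, (('v, 'a) mpoly \<Rightarrow> ('v, 'a) mpoly set) set) module" where
  "T1 V I = quot_module (Hom_module V I) (delta V I ` derivations V)"

text \<open>Degrees are finitely supported integer vectors; homogeneous components in degrees that are
  not non-negative are zero.\<close>

definition mdeg :: "('v \<Rightarrow>\<^sub>0 nat) \<Rightarrow> ('v \<Rightarrow>\<^sub>0 int)" where
  "mdeg m = Poly_Mapping.map int m"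

definition homog :: "'v set \<Rightarrow> ('v \<Rightarrow>\<^sub>0 int) \<Rightarrow> ('v, 'a::field) mpoly set" where
  "homog V c = {p \<in> carrier (poly_ring V). \<forall>m\<in>Poly_Mapping.keys p. mdeg m = c}"

definition Hom_homog ::
  "'v set \<Rightarrow> ('v, 'a::field) mpoly set \<Rightarrow> ('v \<Rightarrow>\<^sub>0 int)
     \<Rightarrow> (('v, 'a) mpoly \<Rightarrow> ('v, 'a) mpoly set) set" where
  "Hom_homog V I a =
     {\<phi> \<in> Hom_quot V I.
        \<forall>c. \<forall>f \<in> I \<inter> homog V c. \<phi> f \<in> (\<lambda>p. I +>\<^bsub>poly_ring V\<^esub> p) ` homog V (c + a)}"

text \<open>The grading of \<open>T\<^sup>1\<close> is the quotient grading: its component of degree \<open>a\<close> consists of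
  the classes of the homomorphisms that are homogeneous of degree \<open>a\<close>.\<close>

definition T1_homog ::
  "'v set \<Rightarrow> ('v, 'a::field) mpoly set \<Rightarrow> ('v \<Rightarrow>\<^sub>0 int)
     \<Rightarrow> ('a, (('v, 'a) mpoly \<Rightarrow> ('v, 'a) mpoly set) set) module" where
  "T1_homog V I a = (T1 V I)
     \<lparr>carrier := (\<lambda>\<phi>. delta V I ` derivations V +>\<^bsub>Hom_module V I\<^esub> \<phi>) ` Hom_homog V I a\<rparr>"

text \<open>The predicate \<open>fin_dim\<close> is needed since \<open>vectorspace.dim\<close> is a junk value
  for infinite-dimensional spaces.\<close>

definition has_dim :: "('a::field, 'b) module \<Rightarrow> nat \<Rightarrow> bool" where
  "has_dim M k \<longleftrightarrow>
     vectorspace.fin_dim (class_ring :: 'a ring) M \<and> vectorspace.dim (class_ring :: 'a ring) M = k"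

definition is_separation ::
  "'v set \<Rightarrow> 'v \<Rightarrow> 'v \<Rightarrow> ('v, 'a::field) mpoly set \<Rightarrow> ('v, 'a) mpoly set \<Rightarrow> bool" where
  "is_separation V i y I J \<longleftrightarrow>
     squarefree_monomial_ideal V I \<and> i \<in> V \<and> y \<notin> V \<and>
     monomial_ideal (insert y V) J \<and>
     I = rename_vars (id(y := i)) ` J \<and>
     (\<exists>f \<in> minimal_generators J. Var i dvd f) \<and>
     (\<exists>f \<in> minimal_generators J. Var y dvd f) \<and>
     (let S' = poly_ring (insert y V); Q = S' Quot J in
        \<forall>q \<in> carrier Q. (J +>\<^bsub>S'\<^esub> (Var y - Var i)) \<otimes>\<^bsub>Q\<^esub> q = \<zero>\<^bsub>Q\<^esub> \<longrightarrow> q = \<zero>\<^bsub>Q\<^esub>)"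

text \<open>The new indeterminate \<open>y\<^sub>j\<close> is taken to be the variable indexed by \<open>v j\<close> from the outset, so
  that only \<open>x\<^sub>i\<close> has to be renamed at the end.\<close>

definition successive_separations ::
  "'v set \<Rightarrow> 'v \<Rightarrow> nat \<Rightarrow> (nat \<Rightarrow> 'v) \<Rightarrow> ('v, 'a::field) mpoly set \<Rightarrow> ('v, 'a) mpoly set \<Rightarrow> bool"
  where
  "successive_separations V i k v I J \<longleftrightarrow>
     (\<exists>\<I>. \<I> 0 = I \<and>
       (\<forall>j\<le>k. squarefree_monomial_ideal (V \<union> v ` {1..j}) (\<I> j)) \<and>
       (\<forall>j\<in>{1..k}. is_separation (V \<union> v ` {1..j - 1}) i (v j) (\<I> (j - 1)) (\<I> j)) \<and>
       J = rename_vars (id(i := v 0)) ` \<I> k)"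

end

theory Submission
  imports Defs
begin

text \<open>A homomorphism \<open>I \<rightarrow> S/I\<close> of degree \<open>-e\<^sub>i\<close> sends \<open>x\<^sub>i x\<^sub>G\<close> to a multiple \<open>c\<^sub>G x\<^sub>G\<close>, for every face
  \<open>G\<close> with \<open>G \<union> {i}\<close> not a face, and it vanishes on the generators without \<open>x\<^sub>i\<close>. Linearity means
  that \<open>c\<close> is constant on the connected components of the poset of these faces, and the homomorphism
  comes from a derivation iff \<open>c\<close> is constant. Hence there are \<open>k + 1\<close> components (or none, if
  \<open>k = 0\<close>), and the separated ideal is obtained from \<open>I\<close> by replacing \<open>x\<^sub>i\<close> in the generator \<open>x\<^sub>i x\<^sub>G\<close> by the
  variable attached to the component of \<open>G\<close>, one component at a time. In the end only one component is
  left at every new vertex, and no generator involves two new vertices.\<close>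

section \<open>Stanley--Reisner ideals in terms of supports\<close>

text \<open>Every complex of the construction is an instance of one definition,
  \<open>split_vertex\<close>, with the base complex \<open>\<Delta>\<close> fixed and only the
  labels varying: the constant label \<open>i\<close> gives \<open>\<Delta>\<close> back, labels
  that distinguish some components give the intermediate ideals, and labels that distinguish all of
  them give the final complex. Labels must be constant along inclusions, because only then is the
  result closed under subsets. This is the condition that linearity imposes on the coefficients of a
  homomorphism, which is why the components of one poset govern both the dimension and the possible
  separations. With k + 1 components there are k separations: component 0 keeps the variable of
  \<open>i\<close> until the closing renaming, just as the partial derivative by that variable
  removes one dimension. This derivative matters only through its values on squarefree monomials,
  where the exponent is 1, so the argument is uniform in the characteristic.\<close>

lemma keys_add_nat: "Poly_Mapping.keys (a + b :: 'v \<Rightarrow>\<^sub>0 nat) = Poly_Mapping.keys a \<union> Poly_Mapping.keys b"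
  by (auto simp: in_keys_iff lookup_add)

lemma sum_singles: "(\<Sum>m\<in>Poly_Mapping.keys p. Poly_Mapping.single m (Poly_Mapping.lookup p m)) = p"
  by (rule poly_mapping_eqI) (auto simp: lookup_sum lookup_single when_def sum.delta in_keys_iff)

lemma keys_sum_subset: "Poly_Mapping.keys (sum f A) \<subseteq> (\<Union>x\<in>A. Poly_Mapping.keys (f x))"
proof (induction A rule: infinite_finite_induct)
  case (insert x F)
  then show ?case using keys_add[of "f x" "sum f F"] by auto
qed auto

definition sqf :: "'v set \<Rightarrow> ('v \<Rightarrow>\<^sub>0 nat)" where
  "sqf N = (\<Sum>w\<in>N. Poly_Mapping.single w 1)"

lemma lookup_sqf: "finite N \<Longrightarrow> Poly_Mapping.lookup (sqf N) w = (if w \<in> N then 1 else 0)"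
  by (simp add: sqf_def lookup_sum lookup_single when_def)

lemma keys_sqf [simp]: "finite N \<Longrightarrow> Poly_Mapping.keys (sqf N) = N"
  by (auto simp: in_keys_iff lookup_sqf split: if_splits)

lemma xpow_add: "xpow (a + b) = (xpow a * xpow b :: ('v, 'a::comm_ring_1) mpoly)"
  by (simp add: xpow_def mult_single)

lemma prod_Var: "finite N \<Longrightarrow> (\<Prod>w\<in>N. Var w) = (xpow (sqf N) :: ('v, 'a::comm_ring_1) mpoly)"
proof (induction N rule: finite_induct)
  case (insert x F)
  then show ?case by (simp add: sqf_def Var_def xpow_add)
qed (simp add: sqf_def xpow_def)

text \<open>Subtraction of exponents is truncated; the inclusion of supports is what makes division
  by the squarefree monomial exact.\<close>

lemma diff_add_sqf:
  assumes "finite N" "N \<subseteq> Poly_Mapping.keys m"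
  shows "m - sqf N + sqf N = m"
  using assms by (intro poly_mapping_eqI) (auto simp: lookup_add lookup_minus lookup_sqf in_keys_iff)

section \<open>The polynomial ring on a set of variables and its ideals of nonfaces\<close>

lemma carrier_poly_ring: "carrier (poly_ring V) = {p. \<forall>m\<in>Poly_Mapping.keys p. Poly_Mapping.keys m \<subseteq> V}"
  and mult_poly_ring [simp]: "mult (poly_ring V) = (*)"
  and one_poly_ring [simp]: "one (poly_ring V) = 1"
  and zero_poly_ring [simp]: "zero (poly_ring V) = 0"
  and add_poly_ring [simp]: "add (poly_ring V) = (+)"
  by (simp_all add: poly_ring_def)

lemma cring_poly_ring: "cring (poly_ring V :: ('v, 'a::comm_ring_1) mpoly ring)"
proof (rule cringI)
  let ?S = "poly_ring V :: ('v, 'a) mpoly ring"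
  show "abelian_group ?S"
  proof (rule abelian_groupI)
    fix x y :: "('v, 'a) mpoly" assume "x \<in> carrier ?S" "y \<in> carrier ?S"
    then show "x \<oplus>\<^bsub>?S\<^esub> y \<in> carrier ?S"
      using keys_add[of x y] by (auto simp: carrier_poly_ring)
  next
    fix x :: "('v, 'a) mpoly" assume "x \<in> carrier ?S"
    then show "\<exists>y\<in>carrier ?S. y \<oplus>\<^bsub>?S\<^esub> x = \<zero>\<^bsub>?S\<^esub>"
      by (intro bexI[of _ "- x"]) (auto simp: carrier_poly_ring in_keys_iff)
  qed (auto simp: carrier_poly_ring algebra_simps)
  show "comm_monoid ?S"
  proof (rule comm_monoidI)
    fix x y :: "('v, 'a) mpoly" assume xy: "x \<in> carrier ?S" "y \<in> carrier ?S"
    show "x \<otimes>\<^bsub>?S\<^esub> y \<in> carrier ?S"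
      unfolding carrier_poly_ring
    proof (clarify, simp)
      fix m v assume "m \<in> Poly_Mapping.keys (x * y)" "v \<in> Poly_Mapping.keys m"
      then obtain a b where "m = a + b" "a \<in> Poly_Mapping.keys x" "b \<in> Poly_Mapping.keys y"
        using keys_mult[of x y] by blast
      then show "v \<in> V" using xy \<open>v \<in> Poly_Mapping.keys m\<close> by (auto simp: carrier_poly_ring keys_add_nat)
    qed
  qed (auto simp: carrier_poly_ring algebra_simps)
qed (auto simp: algebra_simps)

lemma a_inv_poly_ring:
  assumes "p \<in> carrier (poly_ring V)"
  shows "\<ominus>\<^bsub>poly_ring V\<^esub> p = - (p :: ('v, 'a::comm_ring_1) mpoly)"
proof -
  interpret cring "poly_ring V :: ('v, 'a) mpoly ring" by (rule cring_poly_ring)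
  have "- p \<in> carrier (poly_ring V)" using assms by (auto simp: carrier_poly_ring in_keys_iff)
  then show ?thesis using assms minus_equality[of "- p" p] by simp
qed

lemma single_in_poly_ring: "Poly_Mapping.keys m \<subseteq> V \<Longrightarrow> Poly_Mapping.single m c \<in> carrier (poly_ring V)"
  by (simp add: carrier_poly_ring)

lemma xpow_in_poly_ring: "Poly_Mapping.keys m \<subseteq> V \<Longrightarrow> xpow m \<in> carrier (poly_ring V)"
  by (simp add: carrier_poly_ring xpow_def)

lemma Const_in_poly_ring: "Const c \<in> carrier (poly_ring V)"
  by (simp add: carrier_poly_ring Const_def)

lemma Const_mult_xpow: "Const c * xpow m = (Poly_Mapping.single m c :: ('v, 'a::comm_ring_1) mpoly)"
  by (simp add: Const_def xpow_def mult_single)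

text \<open>For a complex \<open>\<Delta>\<close> this is its Stanley--Reisner ideal, described by the supports of its monomials.\<close>

definition face_ideal :: "'v set \<Rightarrow> 'v set set \<Rightarrow> ('v, 'a::zero) mpoly set" where
  "face_ideal V \<Delta> = {p. \<forall>m\<in>Poly_Mapping.keys p. Poly_Mapping.keys m \<subseteq> V \<and> Poly_Mapping.keys m \<notin> \<Delta>}"

lemma face_ideal_subset: "face_ideal V \<Delta> \<subseteq> carrier (poly_ring V)"
  by (auto simp: face_ideal_def carrier_poly_ring)

lemma single_in_face_ideal:
  "c \<noteq> 0 \<Longrightarrow> Poly_Mapping.single m c \<in> face_ideal V \<Delta> \<longleftrightarrow> Poly_Mapping.keys m \<subseteq> V \<and> Poly_Mapping.keys m \<notin> \<Delta>"
  by (simp add: face_ideal_def)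

lemma xpow_in_face_ideal:
  "(xpow m :: ('v, 'a::comm_ring_1) mpoly) \<in> face_ideal V \<Delta> \<longleftrightarrow> Poly_Mapping.keys m \<subseteq> V \<and> Poly_Mapping.keys m \<notin> \<Delta>"
  by (simp add: face_ideal_def xpow_def)

lemma zero_in_face_ideal [simp]: "0 \<in> face_ideal V \<Delta>"
  by (simp add: face_ideal_def)

lemma face_ideal_add: "p \<in> face_ideal V \<Delta> \<Longrightarrow> q \<in> face_ideal V \<Delta> \<Longrightarrow> p + q \<in> face_ideal V \<Delta>"
  using keys_add[of p q] by (auto simp: face_ideal_def)

lemma face_ideal_mult:
  fixes s p :: "('v, 'a::comm_ring_1) mpoly"
  assumes "simplicial_complex V \<Delta>" "s \<in> carrier (poly_ring V)" "p \<in> face_ideal V \<Delta>"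
  shows "s * p \<in> face_ideal V \<Delta>"
  unfolding face_ideal_def
proof (intro CollectI ballI)
  fix m assume "m \<in> Poly_Mapping.keys (s * p)"
  then obtain a b where m: "m = a + b" and "a \<in> Poly_Mapping.keys s" "b \<in> Poly_Mapping.keys p"
    using keys_mult[of s p] by blast
  then have a: "Poly_Mapping.keys a \<subseteq> V" and b: "Poly_Mapping.keys b \<subseteq> V" "Poly_Mapping.keys b \<notin> \<Delta>"
    using assms(2,3) by (auto simp: carrier_poly_ring face_ideal_def)
  have "Poly_Mapping.keys b \<subseteq> Poly_Mapping.keys m" by (simp add: m keys_add_nat)
  then have "Poly_Mapping.keys m \<notin> \<Delta>" using assms(1) b(2) by (auto simp: simplicial_complex_def)
  then show "Poly_Mapping.keys m \<subseteq> V \<and> Poly_Mapping.keys m \<notin> \<Delta>" using a b by (simp add: m keys_add_nat)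
qed

lemma ideal_face_ideal:
  assumes "simplicial_complex V \<Delta>"
  shows "ideal (face_ideal V \<Delta> :: ('v, 'a::comm_ring_1) mpoly set) (poly_ring V)"
proof (rule idealI)
  let ?S = "poly_ring V :: ('v, 'a) mpoly ring"
  interpret cring ?S by (rule cring_poly_ring)
  show "ring ?S" ..
  show "subgroup (face_ideal V \<Delta>) (add_monoid ?S)"
  proof (rule add.subgroupI)
    show "face_ideal V \<Delta> \<subseteq> carrier ?S" by (rule face_ideal_subset)
    show "face_ideal V \<Delta> \<noteq> {}" using zero_in_face_ideal by blast
  next
    fix a :: "('v, 'a) mpoly" assume "a \<in> face_ideal V \<Delta>"
    moreover then have "a \<in> carrier ?S" using face_ideal_subset by blast
    ultimately show "\<ominus>\<^bsub>?S\<^esub> a \<in> face_ideal V \<Delta>"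
      by (simp add: a_inv_poly_ring face_ideal_def in_keys_iff)
  qed (simp add: face_ideal_add)
  fix a x :: "('v, 'a) mpoly" assume "a \<in> face_ideal V \<Delta>" "x \<in> carrier ?S"
  then show "x \<otimes>\<^bsub>?S\<^esub> a \<in> face_ideal V \<Delta>" "a \<otimes>\<^bsub>?S\<^esub> x \<in> face_ideal V \<Delta>"
    using face_ideal_mult[OF assms, of x a] by (simp_all add: mult.commute)
qed

text \<open>A term of a member of \<open>face_ideal\<close> is divisible by the squarefree monomial
  of its own support, and that support is a nonface, so this monomial is one of the
  generators.\<close>

lemma Idl_eq_face_ideal:
  assumes "simplicial_complex V \<Delta>"
  shows "Idl\<^bsub>poly_ring V\<^esub> (xpow ` sqf ` {N. N \<subseteq> V \<and> N \<notin> \<Delta>}) =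
    (face_ideal V \<Delta> :: ('v, 'a::comm_ring_1) mpoly set)"
proof
  let ?S = "poly_ring V :: ('v, 'a) mpoly ring"
  let ?G = "xpow ` sqf ` {N. N \<subseteq> V \<and> N \<notin> \<Delta>} :: ('v, 'a) mpoly set"
  interpret cring ?S by (rule cring_poly_ring)
  have fin: "finite N" if "N \<subseteq> V" for N
    using assms that by (auto simp: simplicial_complex_def intro: finite_subset)
  have G: "?G \<subseteq> face_ideal V \<Delta>" by (auto simp: xpow_in_face_ideal fin)
  then show "Idl\<^bsub>?S\<^esub> ?G \<subseteq> face_ideal V \<Delta>" by (rule genideal_minimal[OF ideal_face_ideal[OF assms]])
  have GS: "?G \<subseteq> carrier ?S" using G face_ideal_subset by blast
  interpret J: ideal "Idl\<^bsub>?S\<^esub> ?G" ?S by (rule genideal_ideal[OF GS])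
  show "face_ideal V \<Delta> \<subseteq> Idl\<^bsub>?S\<^esub> ?G"
  proof
    fix p :: "('v, 'a) mpoly" assume p: "p \<in> face_ideal V \<Delta>"
    have "(\<Sum>m\<in>A. Poly_Mapping.single m (Poly_Mapping.lookup p m)) \<in> Idl\<^bsub>?S\<^esub> ?G"
      if "finite A" "A \<subseteq> Poly_Mapping.keys p" for A
      using that
    proof (induction A rule: finite_induct)
      case empty
      show ?case using J.zero_closed by simp
    next
      case (insert m A)
      let ?N = "Poly_Mapping.keys m"
      have N: "?N \<subseteq> V" "?N \<notin> \<Delta>" using insert.prems p by (auto simp: face_ideal_def)
      have "xpow (sqf ?N) \<in> Idl\<^bsub>?S\<^esub> ?G" using genideal_self[OF GS] N by blast
      moreover have "Poly_Mapping.single (m - sqf ?N) (Poly_Mapping.lookup p m) \<in> carrier ?S"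
        using N(1) by (intro single_in_poly_ring) (auto simp: in_keys_iff lookup_minus)
      ultimately have "Poly_Mapping.single (m - sqf ?N) (Poly_Mapping.lookup p m) * xpow (sqf ?N) \<in> Idl\<^bsub>?S\<^esub> ?G"
        using J.I_l_closed by simp
      then have "Poly_Mapping.single m (Poly_Mapping.lookup p m) \<in> Idl\<^bsub>?S\<^esub> ?G"
        by (simp add: xpow_def mult_single diff_add_sqf)
      then show ?case using insert J.a_closed by simp
    qed
    from this[of "Poly_Mapping.keys p"] show "p \<in> Idl\<^bsub>?S\<^esub> ?G" by (simp add: sum_singles)
  qed
qed

lemma SR_ideal_eq:
  fixes V :: "'v set"
  assumes "simplicial_complex V \<Delta>"
  shows "SR_ideal (K :: 'a::field itself) V \<Delta> = face_ideal V \<Delta>"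
proof -
  have fin: "finite N" if "N \<subseteq> V" for N
    using assms that by (auto simp: simplicial_complex_def intro: finite_subset)
  have "{\<Prod>w\<in>N. Var w | N. N \<subseteq> V \<and> N \<notin> \<Delta>} = (xpow ` sqf ` {N. N \<subseteq> V \<and> N \<notin> \<Delta>} :: ('v, 'a) mpoly set)"
  proof -
    have "xpow (sqf N) = (\<Prod>w\<in>N. Var w :: ('v, 'a) mpoly)" if "N \<subseteq> V" for N
      using fin[OF that] by (rule prod_Var[symmetric])
    then have eq: "(\<exists>N. p = (\<Prod>w\<in>N. Var w) \<and> N \<subseteq> V \<and> N \<notin> \<Delta>) \<longleftrightarrow> p \<in> xpow ` sqf ` {N. N \<subseteq> V \<and> N \<notin> \<Delta>}" for p :: "('v, 'a) mpoly"
      by (auto simp: image_iff)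
    show ?thesis by (intro Set.set_eqI, unfold mem_Collect_eq, rule eq)
  qed
  then show ?thesis by (simp add: SR_ideal_def Idl_eq_face_ideal[OF assms])
qed

lemma squarefree_face_ideal:
  fixes V :: "'v set"
  assumes "simplicial_complex V \<Delta>"
  shows "squarefree_monomial_ideal V (face_ideal V \<Delta> :: ('v, 'a::comm_ring_1) mpoly set)"
proof -
  have fin: "finite N" if "N \<subseteq> V" for N
    using assms that by (auto simp: simplicial_complex_def intro: finite_subset)
  show ?thesis unfolding squarefree_monomial_ideal_def
    by (rule exI[of _ "sqf ` {N. N \<subseteq> V \<and> N \<notin> \<Delta>}"])
       (auto simp: Idl_eq_face_ideal[OF assms] fin lookup_sqf)
qed

lemma monomial_face_ideal:
  assumes "simplicial_complex V \<Delta>"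
  shows "monomial_ideal V (face_ideal V \<Delta> :: ('v, 'a::comm_ring_1) mpoly set)"
proof -
  obtain M where "\<forall>m\<in>M. Poly_Mapping.keys m \<subseteq> V \<and> (\<forall>w. Poly_Mapping.lookup m w \<le> 1)"
    and "(face_ideal V \<Delta> :: ('v, 'a) mpoly set) = Idl\<^bsub>poly_ring V\<^esub> (xpow ` M)"
    using squarefree_face_ideal[OF assms] unfolding squarefree_monomial_ideal_def by (elim exE conjE)
  then show ?thesis unfolding monomial_ideal_def by (intro exI[of _ M] conjI) simp_all
qed

section \<open>Homomorphisms and the quotient by derivations\<close>

locale stanley_reisner =
  fixes K :: "'a::field itself" and V :: "'v set" and \<Delta> :: "'v set set"
  assumes complex: "simplicial_complex V \<Delta>"
begin

abbreviation S :: "('v, 'a) mpoly ring" where "S \<equiv> poly_ring V"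
abbreviation I :: "('v, 'a) mpoly set" where "I \<equiv> face_ideal V \<Delta>"
abbreviation Q :: "('v, 'a) mpoly set ring" where "Q \<equiv> S Quot I"
abbreviation H :: "('a, ('v, 'a) mpoly \<Rightarrow> ('v, 'a) mpoly set) module" where "H \<equiv> Hom_module V I"
abbreviation trivial :: "(('v, 'a) mpoly \<Rightarrow> ('v, 'a) mpoly set) set"
  where "trivial \<equiv> delta V I ` derivations V"
abbreviation cls :: "('v, 'a) mpoly \<Rightarrow> ('v, 'a) mpoly set" where "cls p \<equiv> I +>\<^bsub>S\<^esub> p"

sublocale S: cring S by (rule cring_poly_ring)
sublocale I: ideal I S by (rule ideal_face_ideal[OF complex])
sublocale Q: cring Q by (rule I.quotient_is_cring[OF S.is_cring])

lemma finite_subset_V: "N \<subseteq> V \<Longrightarrow> finite N"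
  using complex finite_subset by (auto simp: simplicial_complex_def)

lemma face_mono: "F \<in> \<Delta> \<Longrightarrow> G \<subseteq> F \<Longrightarrow> G \<in> \<Delta>"
  using complex by (auto simp: simplicial_complex_def)

lemma ideal_carrier: "f \<in> I \<Longrightarrow> f \<in> carrier S"
  using face_ideal_subset by blast

lemma carrier_add: "p \<in> carrier S \<Longrightarrow> q \<in> carrier S \<Longrightarrow> p + q \<in> carrier S"
  and carrier_mult: "p \<in> carrier S \<Longrightarrow> q \<in> carrier S \<Longrightarrow> p * q \<in> carrier S"
  and carrier_zero: "0 \<in> carrier S"
  using S.add.m_closed[of p q] S.m_closed[of p q] S.zero_closed by simp_all

lemma carrier_uminus: "p \<in> carrier S \<Longrightarrow> - p \<in> carrier S"
  using S.a_inv_closed[of p] by (simp add: a_inv_poly_ring)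

lemma carrier_diff: "p \<in> carrier S \<Longrightarrow> q \<in> carrier S \<Longrightarrow> p - q \<in> carrier S"
  using carrier_add[of p "- q"] carrier_uminus by simp

lemma ideal_mult: "s \<in> carrier S \<Longrightarrow> f \<in> I \<Longrightarrow> s * f \<in> I"
  using face_ideal_mult[OF complex] by blast

lemma carrier_Q: "carrier Q = cls ` carrier S"
  by (auto simp: FactRing_def A_RCOSETS_def' a_r_coset_def')

lemma cls_carrier [simp]: "p \<in> carrier S \<Longrightarrow> cls p \<in> carrier Q"
  by (simp add: carrier_Q)

lemma cls_add: "p \<in> carrier S \<Longrightarrow> q \<in> carrier S \<Longrightarrow> cls p \<oplus>\<^bsub>Q\<^esub> cls q = cls (p + q)"
  using ring_hom_add[OF I.rcos_ring_hom, of p q] by simp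

lemma cls_mult: "p \<in> carrier S \<Longrightarrow> q \<in> carrier S \<Longrightarrow> cls p \<otimes>\<^bsub>Q\<^esub> cls q = cls (p * q)"
  using ring_hom_mult[OF I.rcos_ring_hom, of p q] by simp

lemma cls_ideal: "p \<in> I \<Longrightarrow> cls p = \<zero>\<^bsub>Q\<^esub>"
  using I.a_rcos_const by (simp add: FactRing_def)

lemma cls_eq_iff:
  assumes "p \<in> carrier S" "q \<in> carrier S"
  shows "cls p = cls q \<longleftrightarrow> p - q \<in> I"
proof -
  have "cls p = cls q \<longleftrightarrow> p \<in> cls q"
    using assms I.a_rcos_self I.a_repr_independence' by metis
  also have "\<dots> \<longleftrightarrow> p \<oplus>\<^bsub>S\<^esub> \<ominus>\<^bsub>S\<^esub> q \<in> I" using assms by (simp add: I.a_rcos_module)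
  finally show ?thesis using assms by (simp add: a_inv_poly_ring)
qed

lemma cls_zero_iff: "p \<in> carrier S \<Longrightarrow> cls p = \<zero>\<^bsub>Q\<^esub> \<longleftrightarrow> p \<in> I"
  using cls_eq_iff[of p 0] cls_ideal[of 0] carrier_zero by simp

lemma Hom_quotI:
  assumes "\<phi> \<in> I \<rightarrow>\<^sub>E carrier Q"
    and "\<And>f g. f \<in> I \<Longrightarrow> g \<in> I \<Longrightarrow> \<phi> (f + g) = \<phi> f \<oplus>\<^bsub>Q\<^esub> \<phi> g"
    and "\<And>s f. s \<in> carrier S \<Longrightarrow> f \<in> I \<Longrightarrow> \<phi> (s * f) = cls s \<otimes>\<^bsub>Q\<^esub> \<phi> f"
  shows "\<phi> \<in> Hom_quot V I"
  using assms by (simp add: Hom_quot_def Let_def)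

text \<open>Homomorphisms are constructed from functions on polynomials. The laws are required only
  modulo the ideal: a derivation, for example, is not linear over the polynomial ring before classes
  are taken.\<close>

lemma Hom_repI:
  assumes "\<And>f. f \<in> I \<Longrightarrow> r f \<in> carrier S"
    and "\<And>f g. f \<in> I \<Longrightarrow> g \<in> I \<Longrightarrow> r (f + g) - (r f + r g) \<in> I"
    and "\<And>s f. s \<in> carrier S \<Longrightarrow> f \<in> I \<Longrightarrow> r (s * f) - s * r f \<in> I"
  shows "(\<lambda>f\<in>I. cls (r f)) \<in> Hom_quot V I"
proof (rule Hom_quotI)
  show "(\<lambda>f\<in>I. cls (r f)) \<in> I \<rightarrow>\<^sub>E carrier Q" using assms(1) by auto
next
  fix f g assume "f \<in> I" "g \<in> I"
  then show "(\<lambda>f\<in>I. cls (r f)) (f + g) = (\<lambda>f\<in>I. cls (r f)) f \<oplus>\<^bsub>Q\<^esub> (\<lambda>f\<in>I. cls (r f)) g"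
    using assms(1,2) by (simp add: cls_add face_ideal_add cls_eq_iff carrier_add)
next
  fix s f assume "s \<in> carrier S" "f \<in> I"
  then show "(\<lambda>f\<in>I. cls (r f)) (s * f) = cls s \<otimes>\<^bsub>Q\<^esub> (\<lambda>f\<in>I. cls (r f)) f"
    using assms(1,3) by (simp add: cls_mult ideal_mult cls_eq_iff carrier_mult)
qed

lemma Hom_quotD:
  assumes "\<phi> \<in> Hom_quot V I"
  shows Hom_quot_PiE: "\<phi> \<in> I \<rightarrow>\<^sub>E carrier Q"
    and Hom_quot_add: "f \<in> I \<Longrightarrow> g \<in> I \<Longrightarrow> \<phi> (f + g) = \<phi> f \<oplus>\<^bsub>Q\<^esub> \<phi> g"
    and Hom_quot_mult: "s \<in> carrier S \<Longrightarrow> f \<in> I \<Longrightarrow> \<phi> (s * f) = cls s \<otimes>\<^bsub>Q\<^esub> \<phi> f"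
    and Hom_quot_closed: "f \<in> I \<Longrightarrow> \<phi> f \<in> carrier Q"
proof -
  have *: "\<phi> \<in> I \<rightarrow>\<^sub>E carrier Q \<and> (\<forall>f\<in>I. \<forall>g\<in>I. \<phi> (f + g) = \<phi> f \<oplus>\<^bsub>Q\<^esub> \<phi> g) \<and>
        (\<forall>s\<in>carrier S. \<forall>f\<in>I. \<phi> (s * f) = cls s \<otimes>\<^bsub>Q\<^esub> \<phi> f)"
    using assms by (simp add: Hom_quot_def Let_def)
  show "\<phi> \<in> I \<rightarrow>\<^sub>E carrier Q" using * by blast
  then show "f \<in> I \<Longrightarrow> \<phi> f \<in> carrier Q" by blast
  show "f \<in> I \<Longrightarrow> g \<in> I \<Longrightarrow> \<phi> (f + g) = \<phi> f \<oplus>\<^bsub>Q\<^esub> \<phi> g" using * by blast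
  show "s \<in> carrier S \<Longrightarrow> f \<in> I \<Longrightarrow> \<phi> (s * f) = cls s \<otimes>\<^bsub>Q\<^esub> \<phi> f" using * by blast
qed

lemma Hom_quot_ext:
  assumes "\<phi> \<in> Hom_quot V I" "\<psi> \<in> Hom_quot V I" "\<And>f. f \<in> I \<Longrightarrow> \<phi> f = \<psi> f"
  shows "\<phi> = \<psi>"
  using PiE_ext[OF Hom_quot_PiE[OF assms(1)] Hom_quot_PiE[OF assms(2)]] assms(3) by blast

lemma Hom_quot_zero: "\<phi> \<in> Hom_quot V I \<Longrightarrow> \<phi> 0 = \<zero>\<^bsub>Q\<^esub>"
  using Hom_quot_mult[of \<phi> 0 0] Hom_quot_closed[of \<phi> 0] carrier_zero cls_ideal[of 0] by simp

text \<open>Each term of a member of the ideal is a multiple of the monomial of any nonface inside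
  its support. The freedom to choose \<open>N\<close> below \<open>F\<close> allows each application
  to test only convenient generators.\<close>

lemma Hom_quot_eqI:
  assumes \<phi>: "\<phi> \<in> Hom_quot V I" and \<psi>: "\<psi> \<in> Hom_quot V I"
    and gen: "\<And>F. F \<subseteq> V \<Longrightarrow> F \<notin> \<Delta> \<Longrightarrow>
      \<exists>N\<subseteq>F. N \<notin> \<Delta> \<and> \<phi> (xpow (sqf N)) = \<psi> (xpow (sqf N))"
  shows "\<phi> = \<psi>"
proof (rule Hom_quot_ext[OF \<phi> \<psi>])
  fix f assume f: "f \<in> I"
  let ?t = "\<lambda>m. Poly_Mapping.single m (Poly_Mapping.lookup f m)"
  have mono: "?t m \<in> I \<and> \<phi> (?t m) = \<psi> (?t m)" if m: "m \<in> Poly_Mapping.keys f" for m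
  proof -
    have F: "Poly_Mapping.keys m \<subseteq> V" "Poly_Mapping.keys m \<notin> \<Delta>" using f m by (auto simp: face_ideal_def)
    then obtain N where N: "N \<subseteq> Poly_Mapping.keys m" "N \<notin> \<Delta>" and eq: "\<phi> (xpow (sqf N)) = \<psi> (xpow (sqf N))"
      using gen by blast
    have fin: "finite N" using N F finite_subset_V by blast
    have NI: "xpow (sqf N) \<in> I" using N F fin by (auto simp: xpow_in_face_ideal)
    let ?s = "Poly_Mapping.single (m - sqf N) (Poly_Mapping.lookup f m)"
    have s: "?s \<in> carrier S"
      using F(1) by (intro single_in_poly_ring) (auto simp: in_keys_iff lookup_minus)
    have t: "?t m = ?s * xpow (sqf N)" using fin N by (simp add: xpow_def mult_single diff_add_sqf)
    show ?thesis
      using ideal_mult[OF s NI] Hom_quot_mult[OF \<phi> s NI] Hom_quot_mult[OF \<psi> s NI] by (simp add: t eq)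
  qed
  have "sum ?t A \<in> I \<and> \<phi> (sum ?t A) = \<psi> (sum ?t A)" if "finite A" "A \<subseteq> Poly_Mapping.keys f" for A
    using that
  proof (induction A rule: finite_induct)
    case empty
    show ?case using Hom_quot_zero[OF \<phi>] Hom_quot_zero[OF \<psi>] by simp
  next
    case (insert m A)
    then show ?case using mono[of m] Hom_quot_add[OF \<phi>] Hom_quot_add[OF \<psi>] by (simp add: face_ideal_add)
  qed
  from this[of "Poly_Mapping.keys f"] show "\<phi> f = \<psi> f" by (simp add: sum_singles)
qed

section \<open>The vector space of homomorphisms\<close>

lemma carrier_H [simp]: "carrier H = Hom_quot V I"
  and zero_H: "\<zero>\<^bsub>H\<^esub> = (\<lambda>f\<in>I. \<zero>\<^bsub>Q\<^esub>)"
  and add_H: "\<phi> \<oplus>\<^bsub>H\<^esub> \<psi> = (\<lambda>f\<in>I. \<phi> f \<oplus>\<^bsub>Q\<^esub> \<psi> f)"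
  and smult_H: "c \<odot>\<^bsub>H\<^esub> \<phi> = (\<lambda>f\<in>I. cls (Const c) \<otimes>\<^bsub>Q\<^esub> \<phi> f)"
  by (simp_all add: Hom_module_def Let_def)

lemma Hom_smult_closed:
  assumes "\<phi> \<in> Hom_quot V I"
  shows "c \<odot>\<^bsub>H\<^esub> \<phi> \<in> Hom_quot V I"
  unfolding smult_H
proof (rule Hom_quotI)
  have c: "cls (Const c) \<in> carrier Q" by (simp add: Const_in_poly_ring)
  show "(\<lambda>f\<in>I. cls (Const c) \<otimes>\<^bsub>Q\<^esub> \<phi> f) \<in> I \<rightarrow>\<^sub>E carrier Q"
    using c Hom_quot_closed[OF assms] by auto
  fix f assume f: "f \<in> I"
  show "(\<lambda>f\<in>I. cls (Const c) \<otimes>\<^bsub>Q\<^esub> \<phi> f) (f + g) =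
      (\<lambda>f\<in>I. cls (Const c) \<otimes>\<^bsub>Q\<^esub> \<phi> f) f \<oplus>\<^bsub>Q\<^esub> (\<lambda>f\<in>I. cls (Const c) \<otimes>\<^bsub>Q\<^esub> \<phi> f) g" if "g \<in> I" for g
    using f that c Hom_quot_closed[OF assms] by (simp add: face_ideal_add Hom_quot_add[OF assms] Q.r_distr)
  show "(\<lambda>f\<in>I. cls (Const c) \<otimes>\<^bsub>Q\<^esub> \<phi> f) (s * f) =
      cls s \<otimes>\<^bsub>Q\<^esub> (\<lambda>f\<in>I. cls (Const c) \<otimes>\<^bsub>Q\<^esub> \<phi> f) f" if "s \<in> carrier S" for s
    using f that c Hom_quot_closed[OF assms f] cls_carrier[OF that]
    by (simp add: ideal_mult Hom_quot_mult[OF assms] Q.m_lcomm)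
qed

lemma Hom_add_closed:
  assumes "\<phi> \<in> Hom_quot V I" "\<psi> \<in> Hom_quot V I"
  shows "\<phi> \<oplus>\<^bsub>H\<^esub> \<psi> \<in> Hom_quot V I"
  unfolding add_H
proof (rule Hom_quotI)
  note closed = Hom_quot_closed[OF assms(1)] Hom_quot_closed[OF assms(2)]
  show "(\<lambda>f\<in>I. \<phi> f \<oplus>\<^bsub>Q\<^esub> \<psi> f) \<in> I \<rightarrow>\<^sub>E carrier Q" using closed by auto
  fix f assume f: "f \<in> I"
  show "(\<lambda>f\<in>I. \<phi> f \<oplus>\<^bsub>Q\<^esub> \<psi> f) (f + g) =
      (\<lambda>f\<in>I. \<phi> f \<oplus>\<^bsub>Q\<^esub> \<psi> f) f \<oplus>\<^bsub>Q\<^esub> (\<lambda>f\<in>I. \<phi> f \<oplus>\<^bsub>Q\<^esub> \<psi> f) g" if "g \<in> I" for g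
    using f that closed by (simp add: face_ideal_add Hom_quot_add[OF assms(1)] Hom_quot_add[OF assms(2)] Q.a_ac)
  show "(\<lambda>f\<in>I. \<phi> f \<oplus>\<^bsub>Q\<^esub> \<psi> f) (s * f) = cls s \<otimes>\<^bsub>Q\<^esub> (\<lambda>f\<in>I. \<phi> f \<oplus>\<^bsub>Q\<^esub> \<psi> f) f" if "s \<in> carrier S" for s
    using f that closed cls_carrier[OF that]
    by (simp add: ideal_mult Hom_quot_mult[OF assms(1)] Hom_quot_mult[OF assms(2)] Q.r_distr)
qed

lemma Hom_zero_closed: "\<zero>\<^bsub>H\<^esub> \<in> Hom_quot V I"
  unfolding zero_H by (rule Hom_quotI) (auto simp: face_ideal_add ideal_mult)

lemma smult_add_H:
  assumes "\<phi> \<in> Hom_quot V I" "\<psi> \<in> Hom_quot V I"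
  shows "c \<odot>\<^bsub>H\<^esub> (\<phi> \<oplus>\<^bsub>H\<^esub> \<psi>) = c \<odot>\<^bsub>H\<^esub> \<phi> \<oplus>\<^bsub>H\<^esub> c \<odot>\<^bsub>H\<^esub> \<psi>"
  unfolding smult_H add_H
  using Hom_quot_closed[OF assms(1)] Hom_quot_closed[OF assms(2)]
  by (intro ext) (simp add: restrict_def Q.r_distr Const_in_poly_ring)

lemma Const_add_distrib: "Const (c + d) = Const c + (Const d :: ('v, 'a) mpoly)"
  and Const_one: "Const 1 = (1 :: ('v, 'a) mpoly)"
  and Const_zero: "Const 0 = (0 :: ('v, 'a) mpoly)"
  by (simp_all add: Const_def mult_single single_add)

text \<open>The source of additive inverses in \<open>H\<close>: they are obtained from the scalar
  -1.\<close>

lemma smult_minus_one: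
  assumes "\<phi> \<in> Hom_quot V I"
  shows "(- 1) \<odot>\<^bsub>H\<^esub> \<phi> \<oplus>\<^bsub>H\<^esub> \<phi> = \<zero>\<^bsub>H\<^esub>"
proof -
  have "cls (Const (- 1)) \<otimes>\<^bsub>Q\<^esub> \<phi> f \<oplus>\<^bsub>Q\<^esub> \<phi> f = \<zero>\<^bsub>Q\<^esub>" if f: "f \<in> I" for f
  proof -
    obtain p where p: "p \<in> carrier S" "\<phi> f = cls p"
      using Hom_quot_closed[OF assms f] by (auto simp: carrier_Q)
    have "Const (- 1) * p + p = (Const (- 1) + Const 1) * p" by (simp add: Const_one distrib_right)
    also have "\<dots> = 0" by (simp add: Const_add_distrib[symmetric] Const_zero)
    finally show ?thesis
      using p by (simp add: cls_mult cls_add carrier_mult Const_in_poly_ring cls_ideal)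
  qed
  then show ?thesis unfolding smult_H add_H zero_H by (intro ext) (simp add: restrict_def)
qed

lemma abelian_group_H: "abelian_group H"
proof (rule abelian_groupI)
  fix \<phi> assume "\<phi> \<in> carrier H"
  then show "\<exists>\<psi>\<in>carrier H. \<psi> \<oplus>\<^bsub>H\<^esub> \<phi> = \<zero>\<^bsub>H\<^esub>"
    using smult_minus_one Hom_smult_closed by auto
next
  fix \<phi> assume "\<phi> \<in> carrier H"
  then have \<phi>: "\<phi> \<in> Hom_quot V I" by simp
  show "\<zero>\<^bsub>H\<^esub> \<oplus>\<^bsub>H\<^esub> \<phi> = \<phi>"
    by (rule Hom_quot_ext[OF Hom_add_closed[OF Hom_zero_closed \<phi>] \<phi>])
       (simp add: add_H zero_H Hom_quot_closed[OF \<phi>])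
next
  fix \<phi> \<psi> assume "\<phi> \<in> carrier H" "\<psi> \<in> carrier H"
  then show "\<phi> \<oplus>\<^bsub>H\<^esub> \<psi> = \<psi> \<oplus>\<^bsub>H\<^esub> \<phi>"
    unfolding add_H by (intro ext) (simp add: restrict_def Q.a_comm Hom_quot_closed)
next
  fix \<phi> \<psi> \<chi> assume "\<phi> \<in> carrier H" "\<psi> \<in> carrier H" "\<chi> \<in> carrier H"
  then show "\<phi> \<oplus>\<^bsub>H\<^esub> \<psi> \<oplus>\<^bsub>H\<^esub> \<chi> = \<phi> \<oplus>\<^bsub>H\<^esub> (\<psi> \<oplus>\<^bsub>H\<^esub> \<chi>)"
    unfolding add_H by (intro ext) (simp add: restrict_def Q.a_assoc Hom_quot_closed)
qed (simp_all add: Hom_add_closed Hom_zero_closed)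

section \<open>Derivations, trivial homomorphisms and their cosets\<close>

lemma derivations_iff:
  "D \<in> derivations V \<longleftrightarrow> D \<in> carrier S \<rightarrow>\<^sub>E carrier S \<and>
        (\<forall>p\<in>carrier S. \<forall>q\<in>carrier S. D (p + q) = D p + D q) \<and>
        (\<forall>c. \<forall>p\<in>carrier S. D (Const c * p) = Const c * D p) \<and>
        (\<forall>p\<in>carrier S. \<forall>q\<in>carrier S. D (p * q) = p * D q + q * D p)"
  by (simp add: derivations_def Let_def)

lemma derivationsI:
  assumes "\<And>p. p \<in> carrier S \<Longrightarrow> r p \<in> carrier S"
    and "\<And>p q. p \<in> carrier S \<Longrightarrow> q \<in> carrier S \<Longrightarrow> r (p + q) = r p + r q"
    and "\<And>c p. p \<in> carrier S \<Longrightarrow> r (Const c * p) = Const c * r p"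
    and "\<And>p q. p \<in> carrier S \<Longrightarrow> q \<in> carrier S \<Longrightarrow> r (p * q) = p * r q + q * r p"
  shows "(\<lambda>p\<in>carrier S. r p) \<in> derivations V"
  using assms by (simp add: derivations_iff carrier_mult carrier_add Const_in_poly_ring)

lemma derivationsD:
  assumes "D \<in> derivations V" "p \<in> carrier S"
  shows derivation_closed: "D p \<in> carrier S"
    and derivation_add: "q \<in> carrier S \<Longrightarrow> D (p + q) = D p + D q"
    and derivation_Const: "D (Const c * p) = Const c * D p"
    and derivation_mult: "q \<in> carrier S \<Longrightarrow> D (p * q) = p * D q + q * D p"
  using assms by (auto simp only: derivations_iff)

text \<open>By the Leibniz rule D(sf) - s D(f) = f D(s), which lies in the ideal because f
  does.\<close>

lemma delta_in_Hom:
  assumes D: "D \<in> derivations V"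
  shows "delta V I D \<in> Hom_quot V I"
  unfolding delta_def
proof (rule Hom_repI)
  have closed: "D p \<in> carrier S" if "p \<in> carrier S" for p
    using D that by (auto simp: derivations_iff)
  show "D f \<in> carrier S" if "f \<in> I" for f
    using closed that ideal_carrier by blast
  show "D (f + g) - (D f + D g) \<in> I" if "f \<in> I" "g \<in> I" for f g
    using D that ideal_carrier by (simp add: derivations_iff)
  show "D (s * f) - s * D f \<in> I" if "s \<in> carrier S" "f \<in> I" for s f
    using D that ideal_carrier[of f] ideal_mult[of "D s" f] closed[of s]
    by (simp add: derivations_iff mult.commute)
qed

lemma trivial_smult_closed:
  assumes "\<phi> \<in> trivial"
  shows "c \<odot>\<^bsub>H\<^esub> \<phi> \<in> trivial"
proof -
  obtain D where D: "D \<in> derivations V" and \<phi>: "\<phi> = delta V I D" using assms by blast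
  let ?D = "\<lambda>p\<in>carrier S. Const c * D p"
  have closed: "D p \<in> carrier S" if "p \<in> carrier S" for p
    using D that by (auto simp: derivations_iff)
  have "?D \<in> derivations V"
  proof (rule derivationsI)
    fix p q assume p: "p \<in> carrier S" and q: "q \<in> carrier S"
    show "Const c * D (p + q) = Const c * D p + Const c * D q"
      by (simp only: derivation_add[OF D p q] distrib_left)
    show "Const c * D (p * q) = p * (Const c * D q) + q * (Const c * D p)"
      by (simp only: derivation_mult[OF D p q] distrib_left mult.left_commute)
  next
    fix d p assume p: "p \<in> carrier S"
    show "Const c * D p \<in> carrier S" using closed[OF p] by (simp add: carrier_mult Const_in_poly_ring)
    show "Const c * D (Const d * p) = Const d * (Const c * D p)"
      by (simp only: derivation_Const[OF D p] mult.left_commute)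
  qed
  moreover have "c \<odot>\<^bsub>H\<^esub> \<phi> = delta V I ?D"
    unfolding smult_H \<phi> delta_def
    by (intro ext) (simp add: restrict_def ideal_carrier closed cls_mult Const_in_poly_ring)
  ultimately show ?thesis by blast
qed

lemma trivial_add_closed:
  assumes "\<phi> \<in> trivial" "\<psi> \<in> trivial"
  shows "\<phi> \<oplus>\<^bsub>H\<^esub> \<psi> \<in> trivial"
proof -
  obtain D E where D: "D \<in> derivations V" "E \<in> derivations V" and \<phi>: "\<phi> = delta V I D" "\<psi> = delta V I E"
    using assms by blast
  let ?D = "\<lambda>p\<in>carrier S. D p + E p"
  have closed: "D p \<in> carrier S" "E p \<in> carrier S" if "p \<in> carrier S" for p
    using D that by (auto simp: derivations_iff)
  have "?D \<in> derivations V"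
  proof (rule derivationsI)
    fix p q assume p: "p \<in> carrier S" and q: "q \<in> carrier S"
    show "D (p + q) + E (p + q) = D p + E p + (D q + E q)"
      by (simp only: derivation_add[OF D(1) p q] derivation_add[OF D(2) p q] ac_simps)
    show "D (p * q) + E (p * q) = p * (D q + E q) + q * (D p + E p)"
      by (simp only: derivation_mult[OF D(1) p q] derivation_mult[OF D(2) p q] distrib_left ac_simps)
  next
    fix d p assume p: "p \<in> carrier S"
    show "D p + E p \<in> carrier S" using closed[OF p] by (simp add: carrier_add)
    show "D (Const d * p) + E (Const d * p) = Const d * (D p + E p)"
      by (simp only: derivation_Const[OF D(1) p] derivation_Const[OF D(2) p] distrib_left)
  qed
  moreover have "\<phi> \<oplus>\<^bsub>H\<^esub> \<psi> = delta V I ?D"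
    unfolding add_H \<phi> delta_def
    by (intro ext) (simp add: restrict_def ideal_carrier closed cls_add)
  ultimately show ?thesis by blast
qed

lemma trivial_zero_closed: "\<zero>\<^bsub>H\<^esub> \<in> trivial"
proof -
  have "(\<lambda>p\<in>carrier S. 0) \<in> derivations V"
    by (auto simp: derivations_iff carrier_mult carrier_add carrier_zero Const_in_poly_ring)
  moreover have "\<zero>\<^bsub>H\<^esub> = delta V I (\<lambda>p\<in>carrier S. 0)"
    unfolding zero_H delta_def by (intro ext) (simp add: restrict_def ideal_carrier cls_ideal)
  ultimately show ?thesis by blast
qed

sublocale H: abelian_group H by (rule abelian_group_H)

lemma a_inv_H: "\<phi> \<in> Hom_quot V I \<Longrightarrow> \<ominus>\<^bsub>H\<^esub> \<phi> = (- 1) \<odot>\<^bsub>H\<^esub> \<phi>"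
  using H.minus_equality[OF smult_minus_one] Hom_smult_closed by simp

lemma abelian_subgroup_trivial: "abelian_subgroup trivial H"
proof (rule abelian_subgroupI3[OF additive_subgroupI abelian_group_H])
  show "subgroup trivial (add_monoid H)"
  proof (rule H.add.subgroupI)
    show "trivial \<subseteq> carrier H" using delta_in_Hom by auto
    show "trivial \<noteq> {}" using trivial_zero_closed by blast
    fix \<phi> assume "\<phi> \<in> trivial"
    moreover then have "\<phi> \<in> Hom_quot V I" using delta_in_Hom by blast
    ultimately show "\<ominus>\<^bsub>H\<^esub> \<phi> \<in> trivial" using a_inv_H trivial_smult_closed by simp
  qed (rule trivial_add_closed)
qed

sublocale T: abelian_subgroup trivial H by (rule abelian_subgroup_trivial)

lemma T1_homog_simps:
  "carrier (T1_homog V I a) = (\<lambda>\<phi>. trivial +>\<^bsub>H\<^esub> \<phi>) ` Hom_homog V I a"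
  "\<zero>\<^bsub>T1_homog V I a\<^esub> = trivial"
  "add (T1_homog V I a) = set_add H"
  "c \<odot>\<^bsub>T1_homog V I a\<^esub> X = (\<Union>x\<in>X. trivial +>\<^bsub>H\<^esub> (c \<odot>\<^bsub>H\<^esub> x))"
  by (simp_all add: T1_homog_def T1_def quot_module_def)

lemma coset_eq_iff:
  assumes "\<phi> \<in> Hom_quot V I" "\<psi> \<in> Hom_quot V I"
  shows "trivial +>\<^bsub>H\<^esub> \<phi> = trivial +>\<^bsub>H\<^esub> \<psi> \<longleftrightarrow> \<phi> \<ominus>\<^bsub>H\<^esub> \<psi> \<in> trivial"
proof -
  have "trivial +>\<^bsub>H\<^esub> \<phi> = trivial +>\<^bsub>H\<^esub> \<psi> \<longleftrightarrow> \<phi> \<in> trivial +>\<^bsub>H\<^esub> \<psi>"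
    using assms T.a_rcos_self T.a_repr_independence' by (metis carrier_H)
  then show ?thesis using assms by (simp add: T.a_rcos_module a_minus_def)
qed

text \<open>The scalar action on classes is a union over representatives. It collapses to a single
  coset because the trivial homomorphisms are closed under scalars.\<close>

lemma coset_smult:
  assumes "\<phi> \<in> Hom_quot V I"
  shows "(\<Union>x\<in>trivial +>\<^bsub>H\<^esub> \<phi>. trivial +>\<^bsub>H\<^esub> (c \<odot>\<^bsub>H\<^esub> x)) = trivial +>\<^bsub>H\<^esub> (c \<odot>\<^bsub>H\<^esub> \<phi>)"
proof -
  have "trivial +>\<^bsub>H\<^esub> (c \<odot>\<^bsub>H\<^esub> x) = trivial +>\<^bsub>H\<^esub> (c \<odot>\<^bsub>H\<^esub> \<phi>)" if x: "x \<in> trivial +>\<^bsub>H\<^esub> \<phi>" for x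
  proof -
    obtain \<tau> where \<tau>: "\<tau> \<in> trivial" "x = \<tau> \<oplus>\<^bsub>H\<^esub> \<phi>"
      using x unfolding a_r_coset_def' by blast
    have \<tau>H: "\<tau> \<in> Hom_quot V I" using \<tau> delta_in_Hom by blast
    have "c \<odot>\<^bsub>H\<^esub> x = c \<odot>\<^bsub>H\<^esub> \<tau> \<oplus>\<^bsub>H\<^esub> c \<odot>\<^bsub>H\<^esub> \<phi>"
      using smult_add_H[OF \<tau>H assms] \<tau> by simp
    then have "c \<odot>\<^bsub>H\<^esub> x \<in> trivial +>\<^bsub>H\<^esub> (c \<odot>\<^bsub>H\<^esub> \<phi>)"
      using trivial_smult_closed[OF \<tau>(1)] unfolding a_r_coset_def' by blast
    then show ?thesis using T.a_repr_independence' Hom_smult_closed[OF assms] by (metis carrier_H)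
  qed
  moreover have "\<phi> \<in> trivial +>\<^bsub>H\<^esub> \<phi>" using assms T.a_rcos_self by simp
  ultimately show ?thesis by blast
qed

text \<open>The carrier consists of the classes of homogeneous homomorphisms, so at least one of
  these must exist for the zero class to occur.\<close>

lemma T1_homog_trivialI:
  assumes "Hom_homog V I a \<subseteq> trivial" "Hom_homog V I a \<noteq> {}"
  shows "carrier (T1_homog V I a) = {\<zero>\<^bsub>T1_homog V I a\<^esub>}"
proof -
  have "trivial +>\<^bsub>H\<^esub> \<phi> = trivial" if "\<phi> \<in> Hom_homog V I a" for \<phi>
    using T.a_rcos_const assms(1) that by blast
  then show ?thesis using assms(2) by (auto simp: T1_homog_simps)
qed

lemma zero_in_Hom_homog: "\<zero>\<^bsub>H\<^esub> \<in> Hom_homog V I a"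
proof -
  have "\<zero>\<^bsub>H\<^esub> f \<in> cls ` homog V c" if "f \<in> I" for f c
  proof (rule image_eqI)
    show "\<zero>\<^bsub>H\<^esub> f = cls 0" using that by (simp add: zero_H cls_ideal)
  qed (simp add: homog_def carrier_zero)
  then show ?thesis by (auto simp: Hom_homog_def Hom_zero_closed)
qed

end

section \<open>Homomorphisms of degree minus a unit vector\<close>

text \<open>The vector space axioms of \<open>T\<close> are transported along \<open>h\<close> from
  the coordinate space, so a module is never shown to be a vector space beforehand: a compatible
  bijection gives both the structure and the dimension.\<close>

lemma has_dim_bij_betw:
  fixes T :: "('a::field, 'b) module"
  assumes bij: "bij_betw h (carrier_vec n) (carrier T)"
    and add: "\<And>x y. x \<in> carrier_vec n \<Longrightarrow> y \<in> carrier_vec n \<Longrightarrow> h (x + y) = h x \<oplus>\<^bsub>T\<^esub> h y"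
    and smult: "\<And>c x. x \<in> carrier_vec n \<Longrightarrow> h (c \<cdot>\<^sub>v x) = c \<odot>\<^bsub>T\<^esub> h x"
    and zero: "h (0\<^sub>v n) = \<zero>\<^bsub>T\<^esub>"
  shows "has_dim T n"
proof -
  interpret W: vec_space "TYPE('a)" n .
  have im: "carrier T = h ` carrier_vec n" using bij by (simp add: bij_betw_def)
  have T_add: "h x \<oplus>\<^bsub>T\<^esub> h y = h (x + y)" if "x \<in> carrier_vec n" "y \<in> carrier_vec n" for x y
    using add that by simp
  have T_smult: "c \<odot>\<^bsub>T\<^esub> h x = h (c \<cdot>\<^sub>v x)" if "x \<in> carrier_vec n" for c x
    using smult that by simp
  have ab: "abelian_group T"
  proof (rule abelian_groupI)
    show "\<zero>\<^bsub>T\<^esub> \<in> carrier T" using im zero by (metis image_eqI zero_carrier_vec)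
    fix X assume "X \<in> carrier T"
    then obtain x where x: "x \<in> carrier_vec n" "X = h x" using im by blast
    show "\<zero>\<^bsub>T\<^esub> \<oplus>\<^bsub>T\<^esub> X = X" using x by (simp add: zero[symmetric] T_add)
    have "h (- x) \<oplus>\<^bsub>T\<^esub> X = \<zero>\<^bsub>T\<^esub>" using x by (simp add: zero[symmetric] T_add)
    then show "\<exists>Y\<in>carrier T. Y \<oplus>\<^bsub>T\<^esub> X = \<zero>\<^bsub>T\<^esub>" using x im by (metis image_eqI uminus_carrier_vec)
    fix Y assume "Y \<in> carrier T"
    then obtain y where y: "y \<in> carrier_vec n" "Y = h y" using im by blast
    show "X \<oplus>\<^bsub>T\<^esub> Y \<in> carrier T" using x y im by (simp add: T_add)
    show "X \<oplus>\<^bsub>T\<^esub> Y = Y \<oplus>\<^bsub>T\<^esub> X" using x y by (simp add: T_add comm_add_vec)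
    fix Z assume "Z \<in> carrier T"
    then obtain z where z: "z \<in> carrier_vec n" "Z = h z" using im by blast
    show "X \<oplus>\<^bsub>T\<^esub> Y \<oplus>\<^bsub>T\<^esub> Z = X \<oplus>\<^bsub>T\<^esub> (Y \<oplus>\<^bsub>T\<^esub> Z)" using x y z by (simp add: T_add)
  qed
  have "module (class_ring :: 'a ring) T"
  proof (rule moduleI[OF _ ab])
    show "cring (class_ring :: 'a ring)" by (rule class_cring.is_cring)
    fix a b :: 'a and X assume "X \<in> carrier T"
    then obtain x where x: "x \<in> carrier_vec n" "X = h x" using im by blast
    show "a \<odot>\<^bsub>T\<^esub> X \<in> carrier T" using x im by (simp add: T_smult)
    show "(a \<oplus>\<^bsub>class_ring\<^esub> b) \<odot>\<^bsub>T\<^esub> X = a \<odot>\<^bsub>T\<^esub> X \<oplus>\<^bsub>T\<^esub> b \<odot>\<^bsub>T\<^esub> X"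
      using x by (simp add: T_smult T_add add_smult_distrib_vec)
    show "(a \<otimes>\<^bsub>class_ring\<^esub> b) \<odot>\<^bsub>T\<^esub> X = a \<odot>\<^bsub>T\<^esub> (b \<odot>\<^bsub>T\<^esub> X)"
      using x by (simp add: T_smult smult_smult_assoc)
    show "\<one>\<^bsub>class_ring\<^esub> \<odot>\<^bsub>T\<^esub> X = X" using x by (simp add: T_smult)
    fix Y assume "Y \<in> carrier T"
    then obtain y where y: "y \<in> carrier_vec n" "Y = h y" using im by blast
    show "a \<odot>\<^bsub>T\<^esub> (X \<oplus>\<^bsub>T\<^esub> Y) = a \<odot>\<^bsub>T\<^esub> X \<oplus>\<^bsub>T\<^esub> a \<odot>\<^bsub>T\<^esub> Y"
      using x y by (simp add: T_smult T_add smult_add_distrib_vec)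
  qed
  then interpret T: vectorspace "class_ring :: 'a ring" T
    by (rule vectorspace.intro) (rule class_field)
  have "h \<in> LinearCombinations.module_hom class_ring (module_vec TYPE('a) n) T"
    using im add smult by (auto simp: LinearCombinations.module_hom_def module_vec_simps)
  then interpret h: linear_map "class_ring :: 'a ring" "module_vec TYPE('a) n" T h
    by unfold_locales
  have surj: "h ` carrier (module_vec TYPE('a) n) = carrier T" by (simp add: im module_vec_simps)
  have inj: "inj_on h (carrier (module_vec TYPE('a) n))"
    using bij by (simp add: bij_betw_def module_vec_simps)
  have "T.fin_dim" by (rule h.rank_nullity_main(2)[OF W.fin_dim surj])
  moreover have "T.dim = n"
    using h.dim_eq[OF W.fin_dim inj surj] W.dim_is_n by simp
  ultimately show ?thesis by (simp add: has_dim_def)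
qed

section \<open>Linear maps that act on monomials\<close>

lemma mpoly_induct:
  fixes p :: "('v, 'a::comm_ring_1) mpoly"
  assumes "\<And>m. m \<in> Poly_Mapping.keys p \<Longrightarrow> X m"
    and "P 0" and "\<And>m a. X m \<Longrightarrow> P (Poly_Mapping.single m a)" and "\<And>p q. P p \<Longrightarrow> P q \<Longrightarrow> P (p + q)"
  shows "P p"
proof -
  have "P (\<Sum>m\<in>A. Poly_Mapping.single m (Poly_Mapping.lookup p m))"
    if "finite A" "A \<subseteq> Poly_Mapping.keys p" for A
    using that by (induction A rule: finite_induct) (auto intro: assms)
  from this[of "Poly_Mapping.keys p"] show ?thesis by (simp add: sum_singles)
qed

text \<open>The linear map that sends the monomial with exponent m to k(m) times the monomial with
  exponent h(m). Partial derivatives, the homomorphisms of degree minus a unit vector and the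
  renaming of variables all have this form.\<close>

definition linear_ext :: "(('v \<Rightarrow>\<^sub>0 nat) \<Rightarrow> ('w \<Rightarrow>\<^sub>0 nat)) \<Rightarrow> (('v \<Rightarrow>\<^sub>0 nat) \<Rightarrow> 'a) \<Rightarrow>
    ('v, 'a::comm_ring_1) mpoly \<Rightarrow> ('w, 'a) mpoly" where
  "linear_ext h k p = (\<Sum>m\<in>Poly_Mapping.keys p. Poly_Mapping.single (h m) (k m * Poly_Mapping.lookup p m))"

lemma linear_ext_add: "linear_ext h k (p + q) = linear_ext h k p + linear_ext h k q"
  unfolding linear_ext_def
  by (rule setsum_keys_plus_distrib) (simp_all add: distrib_left single_add)

lemma linear_ext_single: "linear_ext h k (Poly_Mapping.single m a) = Poly_Mapping.single (h m) (k m * a)"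
  by (simp add: linear_ext_def)

lemma linear_ext_zero [simp]: "linear_ext h k 0 = 0"
  by (simp add: linear_ext_def)

lemma linear_ext_Const: "linear_ext h k (Const c * p) = Const c * linear_ext h k p"
  by (rule mpoly_induct[of p "\<lambda>_. True"])
     (simp_all add: Const_def mult_single linear_ext_single linear_ext_add distrib_left mult.left_commute)

lemma linear_ext_add_coeff: "linear_ext h (\<lambda>m. k m + k' m) p = linear_ext h k p + linear_ext h k' p"
  by (simp add: linear_ext_def distrib_right single_add sum.distrib)

lemma linear_ext_smult_coeff: "linear_ext h (\<lambda>m. c * k m) p = Const c * linear_ext h k p"
  by (simp add: linear_ext_def sum_distrib_left Const_def mult_single mult.assoc)

lemma keys_linear_ext: "Poly_Mapping.keys (linear_ext h k p) \<subseteq> h ` {m \<in> Poly_Mapping.keys p. k m \<noteq> 0}"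
  unfolding linear_ext_def
  by (rule order_trans[OF keys_sum_subset]) (auto split: if_splits)

text \<open>Division by the variable \<open>u\<close> where it occurs. Elsewhere the truncated
  subtraction leaves the monomial unchanged, so \<open>down\<close> is always paired with
  coefficients that vanish there.\<close>

definition down :: "'v \<Rightarrow> ('v \<Rightarrow>\<^sub>0 nat) \<Rightarrow> ('v \<Rightarrow>\<^sub>0 nat)" where
  "down u m = m - Poly_Mapping.single u 1"

lemma lookup_down: "Poly_Mapping.lookup (down u m) w = (if w = u then Poly_Mapping.lookup m w - 1 else Poly_Mapping.lookup m w)"
  by (simp add: down_def lookup_minus lookup_single when_def)

definition partial :: "'v \<Rightarrow> ('v, 'a::comm_ring_1) mpoly \<Rightarrow> ('v, 'a) mpoly" where
  "partial u = linear_ext (down u) (\<lambda>m. of_nat (Poly_Mapping.lookup m u))"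

lemma add_down: "u \<in> Poly_Mapping.keys m \<Longrightarrow> t + down u m = down u (t + m)"
  by (rule poly_mapping_eqI) (auto simp: lookup_add lookup_down in_keys_iff)

lemma keys_down_subset: "Poly_Mapping.keys (down u m) \<subseteq> Poly_Mapping.keys m"
  by (auto simp: in_keys_iff lookup_down split: if_splits)

lemma keys_down_superset: "Poly_Mapping.keys m - {u} \<subseteq> Poly_Mapping.keys (down u m)"
  by (auto simp: in_keys_iff lookup_down split: if_splits)

lemma down_sqf_insert: "finite G \<Longrightarrow> u \<notin> G \<Longrightarrow> down u (sqf (insert u G)) = sqf G"
  by (rule poly_mapping_eqI) (auto simp: lookup_down lookup_sqf)

lemma partial_single: "partial u (Poly_Mapping.single m a) = Poly_Mapping.single (down u m) (of_nat (Poly_Mapping.lookup m u) * a)"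
  by (simp add: partial_def linear_ext_single)

text \<open>The two summands share the exponent \<open>down u (m + l)\<close>, and their
  coefficients add up to the exponent of u in the product. If u is missing from a factor, the
  exponents may differ, but the summand that differentiates this factor is zero.\<close>

lemma partial_mult_single:
  fixes a b :: "'a::comm_ring_1"
  shows "partial u (Poly_Mapping.single m a * Poly_Mapping.single l b) =
     Poly_Mapping.single m a * partial u (Poly_Mapping.single l b) + Poly_Mapping.single l b * partial u (Poly_Mapping.single m a)"
proof -
  have "Poly_Mapping.single (m + down u l) (a * (of_nat (Poly_Mapping.lookup l u) * b)) =
      Poly_Mapping.single (down u (m + l)) (of_nat (Poly_Mapping.lookup l u) * (a * b))" for m l and a b :: 'a
  proof (cases "u \<in> Poly_Mapping.keys l")
    case True
    then show ?thesis by (simp only: add_down mult.left_commute)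
  qed (simp add: in_keys_iff)
  from this[of m l a b] this[of l m b a] show ?thesis
    by (simp add: partial_single mult_single lookup_add distrib_left distrib_right single_add ac_simps)
qed

lemma partial_mult:
  fixes p q :: "('v, 'a::comm_ring_1) mpoly"
  shows "partial u (p * q) = p * partial u q + q * partial u p"
proof (rule mpoly_induct[of p "\<lambda>_. True"])
  fix m and a :: 'a
  show "partial u (Poly_Mapping.single m a * q) =
      Poly_Mapping.single m a * partial u q + q * partial u (Poly_Mapping.single m a)"
    by (rule mpoly_induct[of q "\<lambda>_. True"])
       (simp_all only: partial_mult_single, simp_all add: partial_def linear_ext_add algebra_simps)
qed (simp_all add: partial_def linear_ext_add algebra_simps)

lemma lookup_mdeg: "Poly_Mapping.lookup (mdeg m) w = int (Poly_Mapping.lookup m w)"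
  by (simp add: mdeg_def Poly_Mapping.map.rep_eq when_def)

lemma mdeg_down: "u \<in> Poly_Mapping.keys m \<Longrightarrow> mdeg (down u m) = mdeg m - Poly_Mapping.single u 1"
  by (rule poly_mapping_eqI) (auto simp: lookup_mdeg lookup_down lookup_minus lookup_single when_def in_keys_iff)

text \<open>The faces of \<open>\<Delta>\<close> outside the closed star of u.\<close>

definition unjoined :: "'v \<Rightarrow> 'v set set \<Rightarrow> 'v set set" where
  "unjoined u \<Delta> = {G \<in> \<Delta>. insert u G \<notin> \<Delta>}"

text \<open>These functions form the zeroth cohomology of the order complex of \<open>U\<close>:
  they are the functions constant on its connected components.\<close>

definition locally_constant :: "'v set set \<Rightarrow> ('v set \<Rightarrow> 'a) \<Rightarrow> bool" where
  "locally_constant U c \<longleftrightarrow> (\<forall>G\<in>U. \<forall>G'\<in>U. G \<subseteq> G' \<longrightarrow> c G = c G')"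

lemma locally_constantD: "locally_constant U c \<Longrightarrow> G \<in> U \<Longrightarrow> G' \<in> U \<Longrightarrow> G \<subseteq> G' \<Longrightarrow> c G = c G'"
  unfolding locally_constant_def by blast

context stanley_reisner begin

lemma unjoinedD:
  assumes "G \<in> unjoined u \<Delta>"
  shows "G \<in> \<Delta>" "insert u G \<notin> \<Delta>" "u \<notin> G" "G \<subseteq> V" "finite G"
proof -
  show *: "G \<in> \<Delta>" "insert u G \<notin> \<Delta>" using assms by (auto simp: unjoined_def)
  then show "u \<notin> G" by (metis insert_absorb)
  show "G \<subseteq> V" using * complex by (auto simp: simplicial_complex_def)
  then show "finite G" by (rule finite_subset_V)
qed

text \<open>If \<open>G'\<close> could be joined with u, so could its subset \<open>G\<close>; hence
  these faces form an up-set of \<open>\<Delta>\<close>.\<close>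

lemma unjoined_mono: "G \<in> unjoined u \<Delta> \<Longrightarrow> G \<subseteq> G' \<Longrightarrow> G' \<in> \<Delta> \<Longrightarrow> G' \<in> unjoined u \<Delta>"
  unfolding unjoined_def using face_mono[of "insert u G'" "insert u G"] by auto

lemma sqf_insert_in_ideal: "u \<in> V \<Longrightarrow> G \<in> unjoined u \<Delta> \<Longrightarrow> xpow (sqf (insert u G)) \<in> I"
  using unjoinedD[of G u] by (simp add: xpow_in_face_ideal)

section \<open>Values of homogeneous homomorphisms on monomials\<close>

lemma Hom_homogD:
  assumes "\<phi> \<in> Hom_homog V I a"
  shows Hom_homog_Hom: "\<phi> \<in> Hom_quot V I"
    and "f \<in> I \<Longrightarrow> f \<in> homog V c \<Longrightarrow> \<phi> f \<in> cls ` homog V (c + a)"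
  using assms by (auto simp: Hom_homog_def)

lemma xpow_in_homog: "Poly_Mapping.keys m \<subseteq> V \<Longrightarrow> xpow m \<in> homog V (mdeg m)"
  by (simp add: homog_def xpow_in_poly_ring) (simp add: xpow_def)

lemma Hom_homog_monomial:
  assumes "\<phi> \<in> Hom_homog V I (- b)" "xpow m \<in> I"
  obtains p where "p \<in> carrier S" "\<phi> (xpow m) = cls p"
    "\<And>l w. l \<in> Poly_Mapping.keys p \<Longrightarrow> int (Poly_Mapping.lookup l w) = int (Poly_Mapping.lookup m w) - Poly_Mapping.lookup b w"
proof -
  have "xpow m \<in> homog V (mdeg m)" using assms(2) by (intro xpow_in_homog) (simp add: xpow_in_face_ideal)
  then obtain p where p: "p \<in> homog V (mdeg m + - b)" "\<phi> (xpow m) = cls p"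
    using Hom_homogD(2)[OF assms(1) assms(2)] by blast
  show thesis
  proof (rule that[of p])
    fix l w assume "l \<in> Poly_Mapping.keys p"
    then have "mdeg l = mdeg m + - b" using p(1) by (simp add: homog_def)
    then have "Poly_Mapping.lookup (mdeg l) w = Poly_Mapping.lookup (mdeg m + - b) w" by simp
    then show "int (Poly_Mapping.lookup l w) = int (Poly_Mapping.lookup m w) - Poly_Mapping.lookup b w"
      by (simp add: lookup_mdeg lookup_add lookup_minus)
  qed (use p in \<open>auto simp: homog_def\<close>)
qed

text \<open>The degree of the image would have a negative entry at w, and no monomial has such a
  degree.\<close>

lemma Hom_homog_small:
  assumes "\<phi> \<in> Hom_homog V I (- b)" "xpow m \<in> I" "int (Poly_Mapping.lookup m w) < Poly_Mapping.lookup b w"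
  shows "\<phi> (xpow m) = \<zero>\<^bsub>Q\<^esub>"
proof (rule Hom_homog_monomial[OF assms(1,2)])
  fix p assume p: "\<phi> (xpow m) = cls p"
    and *: "\<And>l w. l \<in> Poly_Mapping.keys p \<Longrightarrow> int (Poly_Mapping.lookup l w) = int (Poly_Mapping.lookup m w) - Poly_Mapping.lookup b w"
  have "p = 0"
  proof (rule ccontr)
    assume "p \<noteq> 0"
    then obtain l where "l \<in> Poly_Mapping.keys p" by (metis keys_eq_empty all_not_in_conv)
    then show False using *[of l w] assms(3) by simp
  qed
  then show ?thesis using p cls_ideal by simp
qed

text \<open>In degree zero the image of a monomial is a scalar multiple of the same monomial, which
  already lies in the ideal.\<close>

lemma Hom_homog_degree_zero: "\<phi> \<in> Hom_homog V I 0 \<Longrightarrow> xpow m \<in> I \<Longrightarrow> \<phi> (xpow m) = \<zero>\<^bsub>Q\<^esub>"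
proof -
  assume \<phi>: "\<phi> \<in> Hom_homog V I 0" and m: "xpow m \<in> I"
  from \<phi> have "\<phi> \<in> Hom_homog V I (- 0)" by simp
  then show ?thesis
  proof (rule Hom_homog_monomial[OF _ m])
    fix p assume p: "p \<in> carrier S" "\<phi> (xpow m) = cls p"
      and *: "\<And>l w. l \<in> Poly_Mapping.keys p \<Longrightarrow> int (Poly_Mapping.lookup l w) = int (Poly_Mapping.lookup m w) - Poly_Mapping.lookup 0 w"
    have "l = m" if "l \<in> Poly_Mapping.keys p" for l
      using *[OF that] by (intro poly_mapping_eqI) simp
    then have "p \<in> I" using m by (auto simp: face_ideal_def xpow_def)
    then show "\<phi> (xpow m) = \<zero>\<^bsub>Q\<^esub>" using p cls_ideal by simp
  qed
qed

lemma Hom_homog_unit: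
  assumes "\<phi> \<in> Hom_homog V I (- Poly_Mapping.single u 1)" "xpow m \<in> I" "u \<in> Poly_Mapping.keys m"
  obtains a where "\<phi> (xpow m) = cls (Poly_Mapping.single (down u m) a)"
proof (rule Hom_homog_monomial[OF assms(1,2)])
  fix p assume p: "p \<in> carrier S" "\<phi> (xpow m) = cls p"
    and *: "\<And>l w. l \<in> Poly_Mapping.keys p \<Longrightarrow> int (Poly_Mapping.lookup l w) =
      int (Poly_Mapping.lookup m w) - Poly_Mapping.lookup (Poly_Mapping.single u 1) w"
  have "l = down u m" if "l \<in> Poly_Mapping.keys p" for l
  proof (rule poly_mapping_eqI)
    fix w show "Poly_Mapping.lookup l w = Poly_Mapping.lookup (down u m) w"
      using *[OF that, of w] assms(3) by (auto simp: lookup_down lookup_single when_def in_keys_iff)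
  qed
  then have "p = Poly_Mapping.single (down u m) (Poly_Mapping.lookup p (down u m))"
    by (intro poly_mapping_eqI) (auto simp: lookup_single when_def in_keys_iff)
  then show thesis using p that by metis
qed

text \<open>A homomorphism of degree \<open>-e\<^sub>u\<close> sends \<open>x\<^sub>u x\<^sub>G\<close> to a multiple \<open>c\<^sub>G x\<^sub>G\<close>, and linearity
  over the polynomial ring forces \<open>c\<^sub>G = c\<^bsub>G'\<^esub>\<close> for \<open>G \<subseteq> G'\<close> because \<open>x\<^bsub>G'\<^esub>\<close> is not in the ideal.\<close>

lemma Hom_homog_unit_coeffs:
  assumes \<phi>: "\<phi> \<in> Hom_homog V I (- Poly_Mapping.single u 1)" and u: "u \<in> V"
  obtains c where "locally_constant (unjoined u \<Delta>) c"
    "\<And>G. G \<in> unjoined u \<Delta> \<Longrightarrow> \<phi> (xpow (sqf (insert u G))) = cls (Poly_Mapping.single (sqf G) (c G))"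
proof -
  have "\<exists>a. \<phi> (xpow (sqf (insert u G))) = cls (Poly_Mapping.single (sqf G) a)" if G: "G \<in> unjoined u \<Delta>" for G
  proof (rule Hom_homog_unit[OF \<phi> sqf_insert_in_ideal[OF u G]])
    note GD = unjoinedD[OF G]
    show "u \<in> Poly_Mapping.keys (sqf (insert u G))" using GD by simp
    fix a assume "\<phi> (xpow (sqf (insert u G))) = cls (Poly_Mapping.single (down u (sqf (insert u G))) a)"
    then show ?thesis using GD by (auto simp: down_sqf_insert)
  qed
  then obtain c where c: "\<And>G. G \<in> unjoined u \<Delta> \<Longrightarrow>
      \<phi> (xpow (sqf (insert u G))) = cls (Poly_Mapping.single (sqf G) (c G))"
    by metis
  have "c G = c G'" if G: "G \<in> unjoined u \<Delta>" and G': "G' \<in> unjoined u \<Delta>" and sub: "G \<subseteq> G'" for G G'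
  proof -
    note GD = unjoinedD[OF G] and G'D = unjoinedD[OF G']
    let ?s = "sqf (G' - G)"
    have s: "xpow ?s \<in> carrier S" using G'D by (intro xpow_in_poly_ring) auto
    have split: "?s + sqf N = sqf (G' \<union> N)" if "N = G \<or> N = insert u G" for N
      using that G'D GD sub by (intro poly_mapping_eqI) (auto simp: lookup_add lookup_sqf)
    have "xpow ?s * xpow (sqf (insert u G)) = (xpow (sqf (insert u G')) :: ('v, 'a) mpoly)"
      using split[of "insert u G"] sub by (simp add: xpow_add[symmetric] Un_absorb2)
    then have "\<phi> (xpow (sqf (insert u G'))) = cls (xpow ?s) \<otimes>\<^bsub>Q\<^esub> \<phi> (xpow (sqf (insert u G)))"
      using Hom_quot_mult[OF Hom_homogD(1)[OF \<phi>] s sqf_insert_in_ideal[OF u G]] by simp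
    also have "\<dots> = cls (xpow ?s * Poly_Mapping.single (sqf G) (c G))"
      using GD s by (simp add: c[OF G] cls_mult single_in_poly_ring)
    also have "xpow ?s * Poly_Mapping.single (sqf G) (c G) = Poly_Mapping.single (sqf G') (c G)"
      using split[of G] sub by (simp add: xpow_def mult_single Un_absorb2)
    finally have "cls (Poly_Mapping.single (sqf G') (c G')) = cls (Poly_Mapping.single (sqf G') (c G))"
      by (simp add: c[OF G'])
    then have "Poly_Mapping.single (sqf G') (c G' - c G) \<in> I"
      using G'D by (simp add: cls_eq_iff single_in_poly_ring single_diff)
    then show ?thesis using G'D by (cases "c G' - c G = 0") (simp_all add: single_in_face_ideal)
  qed
  then have "locally_constant (unjoined u \<Delta>) c" unfolding locally_constant_def by blast
  then show thesis using c by (rule that)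
qed

text \<open>Below a nonface \<open>F\<close> there is a generator of one of two kinds. If
  \<open>F - {u}\<close> is a face, then \<open>F\<close> arises from a member of
  \<open>unjoined u \<Delta>\<close> by adding u. Otherwise the monomial of \<open>F - {u}\<close>
  is in the ideal, has exponent 0 at u, and is killed by both homomorphisms for reasons of
  degree.\<close>

lemma Hom_homog_unit_eqI:
  assumes \<phi>: "\<phi> \<in> Hom_homog V I (- Poly_Mapping.single u 1)"
    and \<psi>: "\<psi> \<in> Hom_homog V I (- Poly_Mapping.single u 1)"
    and eq: "\<And>G. G \<in> unjoined u \<Delta> \<Longrightarrow> \<phi> (xpow (sqf (insert u G))) = \<psi> (xpow (sqf (insert u G)))"
  shows "\<phi> = \<psi>"
proof (rule Hom_quot_eqI[OF Hom_homogD(1)[OF \<phi>] Hom_homogD(1)[OF \<psi>]])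
  fix F assume F: "F \<subseteq> V" "F \<notin> \<Delta>"
  show "\<exists>N\<subseteq>F. N \<notin> \<Delta> \<and> \<phi> (xpow (sqf N)) = \<psi> (xpow (sqf N))"
  proof (cases "F - {u} \<in> \<Delta>")
    case True
    then have "insert u (F - {u}) = F" using F by (metis Diff_empty Diff_insert0 insert_Diff)
    then have "F - {u} \<in> unjoined u \<Delta>" using True F by (simp add: unjoined_def)
    from eq[OF this] show ?thesis using F \<open>insert u (F - {u}) = F\<close> by auto
  next
    case False
    have fin: "finite (F - {u})" using F finite_subset_V by blast
    have "xpow (sqf (F - {u})) \<in> I" using F False fin by (auto simp: xpow_in_face_ideal)
    then have "\<phi> (xpow (sqf (F - {u}))) = \<psi> (xpow (sqf (F - {u})))"
      using Hom_homog_small[OF \<phi>, of _ u] Hom_homog_small[OF \<psi>, of _ u] fin by (simp add: lookup_sqf)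
    then show ?thesis using False by blast
  qed
qed


section \<open>Homomorphisms from locally constant functions\<close>

definition shift_coeff :: "'v \<Rightarrow> ('v set \<Rightarrow> 'a) \<Rightarrow> ('v \<Rightarrow>\<^sub>0 nat) \<Rightarrow> 'a" where
  "shift_coeff u c m = (if u \<in> Poly_Mapping.keys m then c (Poly_Mapping.keys m - {u}) else 0)"

text \<open>The converse construction, which turns coefficients into a map. Coefficients depend on
  the support alone, so powers are treated like the variable itself, and only the values of
  \<open>c\<close> on \<open>unjoined u \<Delta>\<close> are visible modulo the ideal. Local
  constancy of \<open>c\<close> is what makes the map linear over the polynomial ring.\<close>

definition shift_hom :: "'v \<Rightarrow> ('v set \<Rightarrow> 'a) \<Rightarrow> ('v, 'a) mpoly \<Rightarrow> ('v, 'a) mpoly set" where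
  "shift_hom u c = (\<lambda>f\<in>I. cls (linear_ext (down u) (shift_coeff u c) f))"

lemma linear_ext_down_carrier:
  assumes "p \<in> carrier S"
  shows "linear_ext (down u) k p \<in> carrier S"
  using keys_linear_ext[of "down u" k p] keys_down_subset[of u] assms unfolding carrier_poly_ring by blast

text \<open>Linearity for a product of two terms. Suppose u occurs in \<open>m\<close>. If the
  shifted monomial is supported on a face, then the supports of \<open>m\<close> and
  \<open>t + m\<close> without u are comparable members of \<open>unjoined u \<Delta>\<close>, where
  \<open>c\<close> agrees; otherwise everything lies in the ideal. If u does not occur in
  \<open>m\<close>, the second term vanishes and the support of the first still contains the nonface
  of \<open>m\<close>.\<close>

lemma shift_hom_mult_single:
  assumes c: "locally_constant (unjoined u \<Delta>) c"
    and t: "Poly_Mapping.keys t \<subseteq> V" and m: "Poly_Mapping.keys m \<subseteq> V" "Poly_Mapping.keys m \<notin> \<Delta>"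
  shows "Poly_Mapping.single (down u (t + m)) (shift_coeff u c (t + m) * (a * b)) -
     Poly_Mapping.single t a * Poly_Mapping.single (down u m) (shift_coeff u c m * b) \<in> I"
proof -
  let ?l = "down u (t + m)"
  have l: "Poly_Mapping.keys ?l \<subseteq> V"
    using keys_down_subset[of u "t + m"] t m by (auto simp: keys_add_nat)
  show ?thesis
  proof (cases "u \<in> Poly_Mapping.keys m")
    case True
    have eq: "Poly_Mapping.single ?l (shift_coeff u c (t + m) * (a * b)) -
        Poly_Mapping.single t a * Poly_Mapping.single (down u m) (shift_coeff u c m * b) =
        Poly_Mapping.single ?l ((shift_coeff u c (t + m) - shift_coeff u c m) * (a * b))"
      by (simp add: mult_single add_down[OF True] single_diff[symmetric] algebra_simps)
    show ?thesis
    proof (cases "Poly_Mapping.keys ?l \<in> \<Delta>")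
      case False
      then show ?thesis using l by (simp add: eq face_ideal_def)
    next
      case face: True
      have sub: "Poly_Mapping.keys m - {u} \<subseteq> Poly_Mapping.keys (t + m) - {u}" by (auto simp: keys_add_nat)
      have lsub: "Poly_Mapping.keys (t + m) - {u} \<subseteq> Poly_Mapping.keys ?l" by (rule keys_down_superset)
      have "Poly_Mapping.keys m - {u} \<in> \<Delta>" "Poly_Mapping.keys (t + m) - {u} \<in> \<Delta>"
        using sub lsub face face_mono by blast+
      moreover have "insert u (Poly_Mapping.keys m - {u}) \<notin> \<Delta>" using True m by (simp add: insert_absorb)
      ultimately have U: "Poly_Mapping.keys m - {u} \<in> unjoined u \<Delta>" unfolding unjoined_def by blast
      have "Poly_Mapping.keys (t + m) - {u} \<in> unjoined u \<Delta>"
        by (rule unjoined_mono[OF U sub]) fact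
      with U have "c (Poly_Mapping.keys m - {u}) = c (Poly_Mapping.keys (t + m) - {u})"
        using c sub unfolding locally_constant_def by blast
      then have "shift_coeff u c (t + m) = shift_coeff u c m"
        using True by (simp add: shift_coeff_def keys_add_nat)
      then show ?thesis unfolding eq by simp
    qed
  next
    case False
    then have "Poly_Mapping.keys m \<subseteq> Poly_Mapping.keys ?l"
      using keys_down_superset[of "t + m" u] by (auto simp: keys_add_nat)
    then have "Poly_Mapping.keys ?l \<notin> \<Delta>" using m face_mono by blast
    then show ?thesis using False l by (simp add: shift_coeff_def face_ideal_def)
  qed
qed

lemma shift_hom_in_Hom:
  assumes c: "locally_constant (unjoined u \<Delta>) c"
  shows "shift_hom u c \<in> Hom_quot V I"
  unfolding shift_hom_def
proof (rule Hom_repI)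
  let ?r = "linear_ext (down u) (shift_coeff u c)"
  show "?r f \<in> carrier S" if "f \<in> I" for f using that ideal_carrier linear_ext_down_carrier by blast
  show "?r (f + g) - (?r f + ?r g) \<in> I" for f g by (simp add: linear_ext_add)
  fix s f assume s: "s \<in> carrier S" and f: "f \<in> I"
  show "?r (s * f) - s * ?r f \<in> I"
  proof (rule mpoly_induct[of s "\<lambda>t. Poly_Mapping.keys t \<subseteq> V"])
    show "Poly_Mapping.keys t \<subseteq> V" if "t \<in> Poly_Mapping.keys s" for t
      using s that by (simp add: carrier_poly_ring)
    fix p q assume "?r (p * f) - p * ?r f \<in> I" "?r (q * f) - q * ?r f \<in> I"
    from face_ideal_add[OF this] show "?r ((p + q) * f) - (p + q) * ?r f \<in> I"
      by (simp add: distrib_right linear_ext_add algebra_simps)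
  next
    fix t :: "'v \<Rightarrow>\<^sub>0 nat" and a :: 'a assume t: "Poly_Mapping.keys t \<subseteq> V"
    let ?s = "Poly_Mapping.single t a"
    show "?r (?s * f) - ?s * ?r f \<in> I"
    proof (rule mpoly_induct[of f "\<lambda>m. Poly_Mapping.keys m \<subseteq> V \<and> Poly_Mapping.keys m \<notin> \<Delta>"])
      show "Poly_Mapping.keys m \<subseteq> V \<and> Poly_Mapping.keys m \<notin> \<Delta>" if "m \<in> Poly_Mapping.keys f" for m
        using f that by (simp add: face_ideal_def)
      fix p q assume "?r (?s * p) - ?s * ?r p \<in> I" "?r (?s * q) - ?s * ?r q \<in> I"
      from face_ideal_add[OF this] show "?r (?s * (p + q)) - ?s * ?r (p + q) \<in> I"
        by (simp add: distrib_left linear_ext_add algebra_simps)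
    next
      fix m :: "'v \<Rightarrow>\<^sub>0 nat" and b :: 'a assume "Poly_Mapping.keys m \<subseteq> V \<and> Poly_Mapping.keys m \<notin> \<Delta>"
      then show "?r (?s * Poly_Mapping.single m b) - ?s * ?r (Poly_Mapping.single m b) \<in> I"
        using shift_hom_mult_single[OF c t, of m a b] by (simp add: mult_single[of t a m b] linear_ext_single)
    qed simp
  qed simp
qed

text \<open>The condition on \<open>k\<close> excludes the monomials at which \<open>down\<close> is
  truncated and fails to lower the degree.\<close>

lemma linear_ext_down_homog:
  fixes f :: "('v, 'a) mpoly"
  assumes f: "f \<in> homog V d" and k: "\<And>m. k m \<noteq> 0 \<Longrightarrow> u \<in> Poly_Mapping.keys m"
  shows "linear_ext (down u) k f \<in> homog V (d + - Poly_Mapping.single u 1)"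
  unfolding homog_def
proof (intro CollectI conjI ballI)
  show "linear_ext (down u) k f \<in> carrier S" using f by (simp add: homog_def linear_ext_down_carrier)
  fix l assume "l \<in> Poly_Mapping.keys (linear_ext (down u) k f)"
  then obtain m where "l = down u m" "m \<in> Poly_Mapping.keys f" "k m \<noteq> 0"
    using keys_linear_ext[of "down u" k f] by blast
  then show "mdeg l = d + - Poly_Mapping.single u 1" using f k by (simp add: homog_def mdeg_down)
qed

lemma shift_hom_in_Hom_homog:
  assumes c: "locally_constant (unjoined u \<Delta>) c"
  shows "shift_hom u c \<in> Hom_homog V I (- Poly_Mapping.single u 1)"
  unfolding Hom_homog_def
proof (intro CollectI conjI allI ballI)
  fix d f assume f: "f \<in> I \<inter> homog V d"
  then have "linear_ext (down u) (shift_coeff u c) f \<in> homog V (d + - Poly_Mapping.single u 1)"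
    by (intro linear_ext_down_homog) (auto simp: shift_coeff_def split: if_splits)
  moreover have "shift_hom u c f = cls (linear_ext (down u) (shift_coeff u c) f)"
    using f by (simp add: shift_hom_def)
  ultimately show "shift_hom u c f \<in> cls ` homog V (d + - Poly_Mapping.single u 1)" by blast
qed (rule shift_hom_in_Hom[OF c])

lemma shift_hom_sqf:
  assumes "u \<in> V" "G \<in> unjoined u \<Delta>"
  shows "shift_hom u c (xpow (sqf (insert u G))) = cls (Poly_Mapping.single (sqf G) (c G))"
proof -
  note GD = unjoinedD[OF assms(2)]
  have "insert u G - {u} = G" using GD(3) by blast
  then have "linear_ext (down u) (shift_coeff u c) (xpow (sqf (insert u G))) = Poly_Mapping.single (sqf G) (c G)"
    using GD by (simp add: xpow_def linear_ext_single down_sqf_insert shift_coeff_def)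
  then show ?thesis using sqf_insert_in_ideal[OF assms] by (simp add: shift_hom_def)
qed

lemma shift_hom_add: "shift_hom u (\<lambda>G. c G + c' G) = shift_hom u c \<oplus>\<^bsub>H\<^esub> shift_hom u c'"
proof
  fix f
  have "shift_coeff u (\<lambda>G. c G + c' G) = (\<lambda>m. shift_coeff u c m + shift_coeff u c' m)"
    by (rule ext) (simp add: shift_coeff_def)
  then show "shift_hom u (\<lambda>G. c G + c' G) f = (shift_hom u c \<oplus>\<^bsub>H\<^esub> shift_hom u c') f"
    by (simp add: shift_hom_def add_H linear_ext_add_coeff cls_add linear_ext_down_carrier ideal_carrier restrict_def)
qed

lemma shift_hom_smult: "shift_hom u (\<lambda>G. a * c G) = a \<odot>\<^bsub>H\<^esub> shift_hom u c"
proof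
  fix f
  have "shift_coeff u (\<lambda>G. a * c G) = (\<lambda>m. a * shift_coeff u c m)"
    by (rule ext) (simp add: shift_coeff_def)
  then show "shift_hom u (\<lambda>G. a * c G) f = (a \<odot>\<^bsub>H\<^esub> shift_hom u c) f"
    by (simp add: shift_hom_def smult_H linear_ext_smult_coeff cls_mult linear_ext_down_carrier ideal_carrier
      Const_in_poly_ring restrict_def)
qed

lemma shift_hom_zero: "shift_hom u (\<lambda>G. 0) = \<zero>\<^bsub>H\<^esub>"
proof
  fix f
  have "shift_coeff u (\<lambda>G. 0) = (\<lambda>m. 0)"
    by (rule ext) (simp add: shift_coeff_def)
  then show "shift_hom u (\<lambda>G. 0) f = \<zero>\<^bsub>H\<^esub> f"
    by (simp add: shift_hom_def zero_H linear_ext_def cls_ideal restrict_def)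
qed

lemma shift_hom_diff:
  assumes "locally_constant (unjoined u \<Delta>) c'"
  shows "shift_hom u (\<lambda>G. c G - c' G) = shift_hom u c \<ominus>\<^bsub>H\<^esub> shift_hom u c'"
  using shift_hom_add[of u c "\<lambda>G. - 1 * c' G"] shift_hom_smult[of u "- 1" c'] shift_hom_in_Hom[OF assms]
  by (simp add: a_minus_def a_inv_H)

lemma smult_partial_derivation: "(\<lambda>p\<in>carrier S. Const a * partial u p) \<in> derivations V"
proof (rule derivationsI)
  fix p :: "('v, 'a) mpoly" assume "p \<in> carrier S"
  then show "Const a * partial u p \<in> carrier S"
    by (simp add: partial_def carrier_mult Const_in_poly_ring linear_ext_down_carrier)
  show "Const a * partial u (Const c * p) = Const c * (Const a * partial u p)" for c
    by (simp add: partial_def linear_ext_Const mult.left_commute)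
next
  fix p q :: "('v, 'a) mpoly"
  show "Const a * partial u (p + q) = Const a * partial u p + Const a * partial u q"
    by (simp add: partial_def linear_ext_add distrib_left)
  show "Const a * partial u (p * q) = p * (Const a * partial u q) + q * (Const a * partial u p)"
    by (simp add: partial_mult distrib_left mult.left_commute)
qed

lemma delta_partial_in_Hom_homog:
  "delta V I (\<lambda>p\<in>carrier S. Const a * partial u p) \<in> Hom_homog V I (- Poly_Mapping.single u 1)"
  unfolding Hom_homog_def
proof (intro CollectI conjI allI ballI)
  fix d f assume f: "f \<in> I \<inter> homog V d"
  let ?k = "\<lambda>m. a * of_nat (Poly_Mapping.lookup m u)"
  have "linear_ext (down u) ?k f \<in> homog V (d + - Poly_Mapping.single u 1)"
    using f by (intro linear_ext_down_homog) (auto simp: in_keys_iff intro!: gr0I)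
  moreover have "delta V I (\<lambda>p\<in>carrier S. Const a * partial u p) f = cls (linear_ext (down u) ?k f)"
    using f by (simp add: delta_def ideal_carrier partial_def linear_ext_smult_coeff)
  ultimately show "delta V I (\<lambda>p\<in>carrier S. Const a * partial u p) f \<in> cls ` homog V (d + - Poly_Mapping.single u 1)"
    by blast
qed (rule delta_in_Hom[OF smult_partial_derivation])

text \<open>The exponent of u is 1, so differentiation introduces no integer factor that could
  vanish in the field.\<close>

lemma delta_partial_sqf:
  assumes "u \<in> V" "G \<in> unjoined u \<Delta>"
  shows "delta V I (\<lambda>p\<in>carrier S. Const a * partial u p) (xpow (sqf (insert u G))) =
    cls (Poly_Mapping.single (sqf G) a)"
proof -
  note GD = unjoinedD[OF assms(2)]
  have "Const a * partial u (xpow (sqf (insert u G))) = (Poly_Mapping.single (sqf G) a :: ('v, 'a) mpoly)"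
    using GD by (simp add: xpow_def partial_single down_sqf_insert lookup_sqf Const_def mult_single)
  then show ?thesis using sqf_insert_in_ideal[OF assms] by (simp add: delta_def ideal_carrier)
qed

text \<open>Modulo the ideal, a derivation \<open>D\<close> sends \<open>x\<^sub>u x\<^sub>G\<close> to a polynomial whose coefficient at \<open>x\<^sub>G\<close>
  is the constant coefficient of \<open>D x\<^sub>u\<close>, which does not depend on \<open>G\<close>.\<close>

lemma Hom_homog_unit_trivial_iff:
  assumes \<phi>: "\<phi> \<in> Hom_homog V I (- Poly_Mapping.single u 1)" and u: "u \<in> V"
    and c: "\<And>G. G \<in> unjoined u \<Delta> \<Longrightarrow> \<phi> (xpow (sqf (insert u G))) = cls (Poly_Mapping.single (sqf G) (c G))"
  shows "\<phi> \<in> trivial \<longleftrightarrow> (\<exists>a. \<forall>G\<in>unjoined u \<Delta>. c G = a)"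
proof
  assume "\<exists>a. \<forall>G\<in>unjoined u \<Delta>. c G = a"
  then obtain a where a: "\<forall>G\<in>unjoined u \<Delta>. c G = a" by blast
  \<comment> \<open>A constant value a is realised by a times the partial derivative at u.\<close>
  have "\<phi> = delta V I (\<lambda>p\<in>carrier S. Const a * partial u p)"
    by (rule Hom_homog_unit_eqI[OF \<phi> delta_partial_in_Hom_homog]) (simp add: c delta_partial_sqf[OF u] a)
  then show "\<phi> \<in> trivial" using smult_partial_derivation by blast
next
  assume "\<phi> \<in> trivial"
  then obtain D where D: "D \<in> derivations V" and \<phi>D: "\<phi> = delta V I D" by blast
  have "c G = Poly_Mapping.lookup (D (Var u)) 0" if G: "G \<in> unjoined u \<Delta>" for G
  proof -
    note GD = unjoinedD[OF G]
    have xu: "Var u \<in> carrier S" and xG: "xpow (sqf G) \<in> carrier S"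
      using u GD unfolding Var_def by (auto intro!: xpow_in_poly_ring)
    have "sqf (insert u G) = Poly_Mapping.single u 1 + sqf G"
      using GD by (simp add: sqf_def)
    then have split: "xpow (sqf (insert u G)) = (Var u * xpow (sqf G) :: ('v, 'a) mpoly)"
      by (simp add: Var_def xpow_add)
    have DI: "D (xpow (sqf (insert u G))) = Var u * D (xpow (sqf G)) + xpow (sqf G) * D (Var u)"
      unfolding split by (rule derivation_mult[OF D xu xG])
    have "cls (D (xpow (sqf (insert u G)))) = cls (Poly_Mapping.single (sqf G) (c G))"
      using c[OF G] sqf_insert_in_ideal[OF u G] by (simp add: \<phi>D delta_def)
    then have "Poly_Mapping.single (sqf G) (c G) - D (xpow (sqf (insert u G))) \<in> I"
      using GD derivation_closed[OF D] sqf_insert_in_ideal[OF u G]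
      by (subst cls_eq_iff[symmetric]) (auto simp: single_in_poly_ring ideal_carrier)
    \<comment> \<open>\<open>G\<close> is a face, so the coefficient at its monomial vanishes for
      every element of the ideal.\<close>
    then have "Poly_Mapping.lookup (Poly_Mapping.single (sqf G) (c G) - D (xpow (sqf (insert u G)))) (sqf G) = 0"
      using GD(1,5) unfolding face_ideal_def by (metis (mono_tags, lifting) in_keys_iff keys_sqf mem_Collect_eq)
    then have "c G = Poly_Mapping.lookup (Var u * D (xpow (sqf G))) (sqf G) +
        Poly_Mapping.lookup (xpow (sqf G) * D (Var u)) (sqf G)"
      by (simp add: DI lookup_minus lookup_add)
    also have "Poly_Mapping.lookup (Var u * D (xpow (sqf G))) (sqf G) = 0"
    proof (rule ccontr)
      assume "Poly_Mapping.lookup (Var u * D (xpow (sqf G))) (sqf G) \<noteq> 0"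
      then obtain l where "sqf G = Poly_Mapping.single u 1 + l"
        using keys_mult[of "Var u" "D (xpow (sqf G))"] by (auto simp: in_keys_iff[symmetric] Var_def xpow_def)
      then have "Poly_Mapping.lookup (sqf G) u = 1 + Poly_Mapping.lookup l u" by (simp add: lookup_add)
      then show False using GD by (simp add: lookup_sqf)
    qed
    also have "Poly_Mapping.lookup (xpow (sqf G) * D (Var u)) (sqf G) = Poly_Mapping.lookup (D (Var u)) 0"
      by (simp add: xpow_def lookup_mult lookup_single when_mult)
    finally show ?thesis by simp
  qed
  then show "\<exists>a. \<forall>G\<in>unjoined u \<Delta>. c G = a" by blast
qed

lemma T1_unit_trivialI:
  assumes u: "u \<in> V"
    and const: "\<And>(c :: 'v set \<Rightarrow> 'a) G G'. locally_constant (unjoined u \<Delta>) c \<Longrightarrow>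
      G \<in> unjoined u \<Delta> \<Longrightarrow> G' \<in> unjoined u \<Delta> \<Longrightarrow> c G = c G'"
  shows "Hom_homog V I (- Poly_Mapping.single u 1) \<subseteq> trivial"
proof
  fix \<phi> assume \<phi>: "\<phi> \<in> Hom_homog V I (- Poly_Mapping.single u 1)"
  show "\<phi> \<in> trivial"
  proof (rule Hom_homog_unit_coeffs[OF \<phi> u])
    fix c assume lc: "locally_constant (unjoined u \<Delta>) c"
      and c: "\<And>G. G \<in> unjoined u \<Delta> \<Longrightarrow> \<phi> (xpow (sqf (insert u G))) = cls (Poly_Mapping.single (sqf G) (c G))"
    \<comment> \<open>If there are no such faces, any \<open>a\<close> serves.\<close>
    have "\<exists>a. \<forall>G\<in>unjoined u \<Delta>. c G = a" using const[OF lc] by blast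
    then show "\<phi> \<in> trivial" using Hom_homog_unit_trivial_iff[OF \<phi> u c] by blast
  qed
qed


text \<open>Locally constant functions have one coordinate for each of the r components, and the
  trivial homomorphisms correspond to the constants. Normalising the value on the last component to
  0 leaves r - 1 coordinates. If there is no component, the truncated subtraction gives 0, which is
  again the dimension.\<close>

lemma has_dim_T1_unit:
  assumes u: "u \<in> V"
    and cmp: "cmp ` unjoined u \<Delta> = {..<r}"
    and sub: "\<And>G G'. G \<in> unjoined u \<Delta> \<Longrightarrow> G' \<in> unjoined u \<Delta> \<Longrightarrow> G \<subseteq> G' \<Longrightarrow> cmp G = cmp G'"
    and const: "\<And>(c :: 'v set \<Rightarrow> 'a) G G'. locally_constant (unjoined u \<Delta>) c \<Longrightarrow>
      G \<in> unjoined u \<Delta> \<Longrightarrow> G' \<in> unjoined u \<Delta> \<Longrightarrow> cmp G = cmp G' \<Longrightarrow> c G = c G'"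
  shows "has_dim (T1_homog V I (- Poly_Mapping.single u 1)) (r - 1)"
proof -
  let ?T = "T1_homog V I (- Poly_Mapping.single u 1)"
  let ?U = "unjoined u \<Delta>"
  define n where "n = r - 1"
  \<comment> \<open>Component n is the reference component and receives the value 0.\<close>
  define cv where "cv x G = (if cmp G < n then x $ cmp G else 0)" for x :: "'a vec" and G
  define h where "h x = trivial +>\<^bsub>H\<^esub> shift_hom u (cv x)" for x
  have lc: "locally_constant ?U (cv x)" for x
    unfolding locally_constant_def
  proof (intro ballI impI)
    fix G G' assume "G \<in> ?U" "G' \<in> ?U" "G \<subseteq> G'"
    from sub[OF this] show "cv x G = cv x G'" unfolding cv_def by (rule arg_cong)
  qed
  have hom: "shift_hom u (cv x) \<in> Hom_quot V I" for x by (rule shift_hom_in_Hom[OF lc])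
  have lc_diff: "locally_constant ?U (\<lambda>G. c G - c' G)" if "locally_constant ?U c" "locally_constant ?U c'"
    for c c' :: "'v set \<Rightarrow> 'a"
    unfolding locally_constant_def
  proof (intro ballI impI)
    fix G G' assume "G \<in> ?U" "G' \<in> ?U" "G \<subseteq> G'"
    then show "c G - c' G = c G' - c' G'"
      using that by (intro arg_cong2[of _ _ _ _ minus] locally_constantD)
  qed
  have coset_eq: "trivial +>\<^bsub>H\<^esub> shift_hom u c = trivial +>\<^bsub>H\<^esub> shift_hom u c' \<longleftrightarrow> (\<exists>a. \<forall>G\<in>?U. c G - c' G = a)"
    if "locally_constant ?U c" "locally_constant ?U c'" for c c'
  proof -
    have "trivial +>\<^bsub>H\<^esub> shift_hom u c = trivial +>\<^bsub>H\<^esub> shift_hom u c' \<longleftrightarrow>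
        shift_hom u (\<lambda>G. c G - c' G) \<in> trivial"
      by (simp only: coset_eq_iff[OF that[THEN shift_hom_in_Hom]] shift_hom_diff[OF that(2)])
    also have "\<dots> \<longleftrightarrow> (\<exists>a. \<forall>G\<in>?U. c G - c' G = a)"
      by (rule Hom_homog_unit_trivial_iff[OF shift_hom_in_Hom_homog[OF lc_diff[OF that]] u shift_hom_sqf[OF u]])
    finally show ?thesis .
  qed
  have "has_dim ?T n"
  proof (rule has_dim_bij_betw[of h])
    fix x y :: "'a vec" and c :: 'a
    assume x: "x \<in> carrier_vec n"
    have "cv (c \<cdot>\<^sub>v x) = (\<lambda>G. c * cv x G)" using x by (intro ext) (simp add: cv_def)
    then show "h (c \<cdot>\<^sub>v x) = c \<odot>\<^bsub>?T\<^esub> h x"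
      by (simp only: h_def T1_homog_simps coset_smult[OF hom] shift_hom_smult)
    assume y: "y \<in> carrier_vec n"
    have "cv (x + y) = (\<lambda>G. cv x G + cv y G)" using x y by (intro ext) (simp add: cv_def)
    moreover have "trivial +>\<^bsub>H\<^esub> shift_hom u (cv x) <+>\<^bsub>H\<^esub> (trivial +>\<^bsub>H\<^esub> shift_hom u (cv y)) =
        trivial +>\<^bsub>H\<^esub> (shift_hom u (cv x) \<oplus>\<^bsub>H\<^esub> shift_hom u (cv y))"
      using hom by (intro T.a_rcos_sum) simp_all
    ultimately show "h (x + y) = h x \<oplus>\<^bsub>?T\<^esub> h y"
      by (simp only: h_def T1_homog_simps shift_hom_add)
  next
    have "cv (0\<^sub>v n) = (\<lambda>G. 0)" by (intro ext) (simp add: cv_def)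
    then have "h (0\<^sub>v n) = trivial +>\<^bsub>H\<^esub> \<zero>\<^bsub>H\<^esub>" by (simp only: h_def shift_hom_zero)
    then show "h (0\<^sub>v n) = \<zero>\<^bsub>?T\<^esub>" using T.a_rcos_const[OF trivial_zero_closed] by (simp only: T1_homog_simps)
  next
    show "bij_betw h (carrier_vec n) (carrier ?T)"
      unfolding bij_betw_def
    proof
      show "inj_on h (carrier_vec n)"
      proof (rule inj_onI)
        fix x y :: "'a vec" assume x: "x \<in> carrier_vec n" and y: "y \<in> carrier_vec n" and eq: "h x = h y"
        from eq obtain a where a: "\<And>G. G \<in> ?U \<Longrightarrow> cv x G - cv y G = a"
          using coset_eq[OF lc lc, of x y] unfolding h_def by blast
        show "x = y"
        proof (rule eq_vecI)
          fix j assume "j < dim_vec y"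
          then have j: "j < n" using y by simp
          \<comment> \<open>An index below n exists only if r is at least 2, and then the reference
            component n is inhabited. Its value 0 under both functions forces their constant
            difference \<open>a\<close> to be 0.\<close>
          then have "j \<in> cmp ` ?U" "n \<in> cmp ` ?U" using cmp by (auto simp: n_def)
          then obtain G G' where G: "G \<in> ?U" "cmp G = j" "G' \<in> ?U" "cmp G' = n" by blast
          have "a = 0" using a[OF G(3)] G(4) by (simp add: cv_def)
          then show "x $ j = y $ j" using a[OF G(1)] G(2) j by (simp add: cv_def)
        qed (use x y in simp)
      qed
      have "h x \<in> carrier ?T" for x
        unfolding T1_homog_simps h_def using shift_hom_in_Hom_homog[OF lc] by blast
      moreover have "\<exists>x\<in>carrier_vec n. X = h x" if X: "X \<in> carrier ?T" for X
      proof -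
        obtain \<phi> where \<phi>: "\<phi> \<in> Hom_homog V I (- Poly_Mapping.single u 1)" and X\<phi>: "X = trivial +>\<^bsub>H\<^esub> \<phi>"
          using X unfolding T1_homog_simps by blast
        obtain c where c: "locally_constant ?U c"
          "\<And>G. G \<in> ?U \<Longrightarrow> \<phi> (xpow (sqf (insert u G))) = cls (Poly_Mapping.single (sqf G) (c G))"
          using Hom_homog_unit_coeffs[OF \<phi> u] by metis
        have \<phi>_eq: "\<phi> = shift_hom u c"
          by (rule Hom_homog_unit_eqI[OF \<phi> shift_hom_in_Hom_homog[OF c(1)]]) (simp add: c(2) shift_hom_sqf[OF u])
        \<comment> \<open>By \<open>const\<close>, the value does not depend on the representative
          chosen in the component.\<close>
        define cval where "cval j = c (SOME G. G \<in> ?U \<and> cmp G = j)" for j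
        have cval: "cval (cmp G) = c G" if "G \<in> ?U" for G
        proof -
          have "(SOME G'. G' \<in> ?U \<and> cmp G' = cmp G) \<in> ?U \<and> cmp (SOME G'. G' \<in> ?U \<and> cmp G' = cmp G) = cmp G"
            by (rule someI[of _ G]) (simp add: that)
          then show ?thesis unfolding cval_def using const[OF c(1) _ that] by blast
        qed
        \<comment> \<open>Subtracting the constant \<open>cval n\<close> does not change the class
          and makes the value on the reference component 0.\<close>
        define x where "x = vec n (\<lambda>j. cval j - cval n)"
        have "c G - cv x G = cval n" if "G \<in> ?U" for G
        proof (cases "cmp G < n")
          case True
          then show ?thesis using cval[OF that] by (simp add: cv_def x_def)
        next
          case False
          have "cmp G < r" using cmp that by blast
          then have "cmp G = n" using False by (simp add: n_def)
          then show ?thesis using cval[OF that] False by (simp add: cv_def)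
        qed
        then have "X = h x" unfolding X\<phi> \<phi>_eq h_def coset_eq[OF c(1) lc] by blast
        then show ?thesis by (auto simp: x_def)
      qed
      ultimately show "h ` carrier_vec n = carrier ?T" by blast
    qed
  qed
  then show ?thesis by (simp add: n_def)
qed

end

text \<open>The comparability relation is symmetric, so its reflexive transitive closure is an
  equivalence; its classes are the components, and \<open>cmp\<close> numbers them. A locally
  constant function does not change along a chain of comparabilities.\<close>

lemma components_exist:
  assumes "finite U"
  obtains cmp :: "'v set \<Rightarrow> nat" and r where "cmp ` U = {..<r}"
    and "\<And>G G'. G \<in> U \<Longrightarrow> G' \<in> U \<Longrightarrow> G \<subseteq> G' \<Longrightarrow> cmp G = cmp G'"
    and "\<And>(c :: 'v set \<Rightarrow> 'a) G G'. locally_constant U c \<Longrightarrow> G \<in> U \<Longrightarrow> G' \<in> U \<Longrightarrow> cmp G = cmp G' \<Longrightarrow> c G = c G'"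
proof -
  \<comment> \<open>The closure also relates every set outside \<open>U\<close> to itself; the
    intersection removes these pairs.\<close>
  define R where "R = {(G, G'). G \<in> U \<and> G' \<in> U \<and> (G \<subseteq> G' \<or> G' \<subseteq> G)}\<^sup>* \<inter> U \<times> U"
  have equiv: "equiv U R"
  proof (rule equivI)
    show "R \<subseteq> U \<times> U" "refl_on U R" by (auto simp: R_def refl_on_def)
    have "sym ({(G, G'). G \<in> U \<and> G' \<in> U \<and> (G \<subseteq> G' \<or> G' \<subseteq> G)}\<^sup>*)"
      by (rule sym_rtrancl) (auto simp: sym_def)
    then show "sym R" by (auto simp: R_def sym_def)
    show "trans R" unfolding R_def by (rule transI) (auto intro: rtrancl_trans)
  qed
  have "finite (U // R)" using assms equiv by (simp add: finite_quotient equiv_type)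
  then obtain g where g: "bij_betw g (U // R) {..<card (U // R)}"
    using ex_bij_betw_finite_nat by (metis atLeast0LessThan)
  define cmp where "cmp G = g (R `` {G})" for G
  have cmp_eq: "cmp G = cmp G' \<longleftrightarrow> (G, G') \<in> R" if "G \<in> U" "G' \<in> U" for G G'
  proof -
    have "R `` {G} \<in> U // R" "R `` {G'} \<in> U // R" using that by (auto intro: quotientI)
    then have "cmp G = cmp G' \<longleftrightarrow> R `` {G} = R `` {G'}"
      unfolding cmp_def by (rule inj_on_eq_iff[OF bij_betw_imp_inj_on[OF g]])
    then show ?thesis using equiv that by (simp add: eq_equiv_class_iff)
  qed
  show thesis
  proof (rule that[of cmp "card (U // R)"])
    have "cmp ` U = g ` (U // R)" by (auto simp: cmp_def quotient_def)
    then show "cmp ` U = {..<card (U // R)}" using g by (simp add: bij_betw_def)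
  next
    fix G G' assume "G \<in> U" "G' \<in> U" "G \<subseteq> G'"
    then show "cmp G = cmp G'" by (subst cmp_eq) (auto simp: R_def)
  next
    fix c :: "'v set \<Rightarrow> 'a" and G G'
    assume c: "locally_constant U c" and GU: "G \<in> U" "G' \<in> U" "cmp G = cmp G'"
    then have "(G, G') \<in> {(G, G'). G \<in> U \<and> G' \<in> U \<and> (G \<subseteq> G' \<or> G' \<subseteq> G)}\<^sup>*"
      by (simp add: cmp_eq R_def)
    then show "c G = c G'"
    proof (induction rule: rtrancl_induct)
      case (step y z)
      from step(2) have yz: "y \<in> U" "z \<in> U" "y \<subseteq> z \<or> z \<subseteq> y" by auto
      from yz(3) have "c y = c z"
      proof
        assume "y \<subseteq> z"
        with c yz(1,2) show ?thesis by (rule locally_constantD)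
      next
        assume "z \<subseteq> y"
        with c yz(2,1) show ?thesis by (rule locally_constantD[symmetric])
      qed
      with step(3) show ?case by (rule trans)
    qed simp
  qed
qed

section \<open>Separations by labels\<close>

text \<open>Membership in a split complex is decided by the part of a set inside W and by one label.
  Renaming labels must therefore leave that part alone.\<close>

lemma image_Int_fixed:
  assumes "\<And>w. w \<in> F \<Longrightarrow> w \<in> W \<Longrightarrow> f w = w" "\<And>w. w \<in> F \<Longrightarrow> w \<notin> W \<Longrightarrow> f w \<notin> W"
  shows "f ` F \<inter> W = F \<inter> W"
proof (rule equalityI; rule subsetI)
  fix x assume "x \<in> f ` F \<inter> W"
  then obtain w where w: "w \<in> F" "x = f w" "f w \<in> W" by blast
  then have "w \<in> W" using assms(2) by blast
  then show "x \<in> F \<inter> W" using w assms(1) by simp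
next
  fix x assume "x \<in> F \<inter> W"
  then show "x \<in> f ` F \<inter> W" using assms(1)[of x] by (intro IntI image_eqI[of _ _ x]) simp_all
qed

section \<open>Substitution of variables in ideals of nonfaces\<close>

definition rename_monom :: "('v \<Rightarrow> 'w) \<Rightarrow> ('v \<Rightarrow>\<^sub>0 nat) \<Rightarrow> ('w \<Rightarrow>\<^sub>0 nat)" where
  "rename_monom \<rho> m = (\<Sum>w\<in>Poly_Mapping.keys m. Poly_Mapping.single (\<rho> w) (Poly_Mapping.lookup m w))"

lemma prod_xpow: "(\<Prod>w\<in>A. xpow (f w)) = (xpow (sum f A) :: ('v, 'a::comm_ring_1) mpoly)"
proof (induction A rule: infinite_finite_induct)
  case (insert x F)
  then show ?case by (simp add: xpow_add)
qed (simp_all add: xpow_def)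

lemma Var_power: "Var w ^ n = (xpow (Poly_Mapping.single w n) :: ('v, 'a::comm_ring_1) mpoly)"
proof (induction n)
  case (Suc n)
  have "Poly_Mapping.single w (Suc n) = Poly_Mapping.single w 1 + Poly_Mapping.single w n"
    by (simp add: single_add[symmetric])
  then show ?case using Suc by (simp only: power_Suc Var_def xpow_add)
qed (simp add: xpow_def)

lemma rename_vars_eq: "rename_vars \<rho> = linear_ext (rename_monom \<rho>) (\<lambda>_. 1)"
  by (rule ext) (simp add: rename_vars_def linear_ext_def Var_power prod_xpow rename_monom_def Const_mult_xpow)

lemma keys_rename_monom: "Poly_Mapping.keys (rename_monom \<rho> m) = \<rho> ` Poly_Mapping.keys m"
proof -
  have "Poly_Mapping.keys (\<Sum>w\<in>A. Poly_Mapping.single (\<rho> w) (Poly_Mapping.lookup m w)) = \<rho> ` A"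
    if "finite A" "A \<subseteq> Poly_Mapping.keys m" for A
    using that by (induction A rule: finite_induct) (simp_all add: keys_add_nat in_keys_iff)
  then show ?thesis by (simp add: rename_monom_def)
qed

lemma rename_monom_section:
  assumes "\<And>w. w \<in> Poly_Mapping.keys m \<Longrightarrow> \<rho> (\<sigma> w) = w"
  shows "rename_monom \<rho> (rename_monom \<sigma> m) = m"
proof -
  have add: "rename_monom \<rho> (a + b) = rename_monom \<rho> a + rename_monom \<rho> b" for a b
    unfolding rename_monom_def by (rule setsum_keys_plus_distrib) (simp_all add: single_add)
  have single: "rename_monom \<rho> (Poly_Mapping.single w n) = Poly_Mapping.single (\<rho> w) n" for w n
    by (simp add: rename_monom_def)
  have zero: "rename_monom \<rho> 0 = 0" by (simp add: rename_monom_def)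
  have "rename_monom \<rho> (\<Sum>w\<in>A. Poly_Mapping.single (\<sigma> w) (Poly_Mapping.lookup m w)) =
      (\<Sum>w\<in>A. Poly_Mapping.single w (Poly_Mapping.lookup m w))" if "finite A" "A \<subseteq> Poly_Mapping.keys m" for A
    using that by (induction A rule: finite_induct) (simp_all add: zero add single assms)
  from this[of "Poly_Mapping.keys m"] show ?thesis by (simp add: rename_monom_def[of \<sigma>] sum_singles)
qed

text \<open>The image is closed under sums, so the terms can be lifted one at a time. The section
  \<open>\<sigma>\<close> may thus depend on the nonface \<open>F\<close>; one section for all
  nonfaces need not exist, since different nonfaces with a common vertex can require different
  labels for it.\<close>

lemma rename_vars_face_ideal:
  fixes \<rho> :: "'v \<Rightarrow> 'w"
  assumes forth: "\<And>F. F \<subseteq> V' \<Longrightarrow> F \<notin> \<Delta>' \<Longrightarrow> \<rho> ` F \<subseteq> V \<and> \<rho> ` F \<notin> \<Delta>"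
    and lift: "\<And>F. F \<subseteq> V \<Longrightarrow> F \<notin> \<Delta> \<Longrightarrow> \<exists>\<sigma>. (\<forall>w\<in>F. \<rho> (\<sigma> w) = w) \<and> \<sigma> ` F \<subseteq> V' \<and> \<sigma> ` F \<notin> \<Delta>'"
  shows "(face_ideal V \<Delta> :: ('w, 'a::comm_ring_1) mpoly set) = rename_vars \<rho> ` face_ideal V' \<Delta>'"
proof
  show "rename_vars \<rho> ` face_ideal V' \<Delta>' \<subseteq> (face_ideal V \<Delta> :: ('w, 'a) mpoly set)"
  proof
    fix q :: "('w, 'a) mpoly" assume "q \<in> rename_vars \<rho> ` face_ideal V' \<Delta>'"
    then obtain p :: "('v, 'a) mpoly" where p: "p \<in> face_ideal V' \<Delta>'" and q: "q = rename_vars \<rho> p" by blast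
    show "q \<in> face_ideal V \<Delta>" unfolding face_ideal_def
    proof (intro CollectI ballI)
      fix l assume "l \<in> Poly_Mapping.keys q"
      then obtain m where "m \<in> Poly_Mapping.keys p" "l = rename_monom \<rho> m"
        using keys_linear_ext[of "rename_monom \<rho>" "\<lambda>_. 1" p] unfolding q rename_vars_eq by blast
      then show "Poly_Mapping.keys l \<subseteq> V \<and> Poly_Mapping.keys l \<notin> \<Delta>"
        using p forth by (simp add: face_ideal_def keys_rename_monom)
    qed
  qed
  show "(face_ideal V \<Delta> :: ('w, 'a) mpoly set) \<subseteq> rename_vars \<rho> ` face_ideal V' \<Delta>'"
  proof
    fix p :: "('w, 'a) mpoly" assume p: "p \<in> face_ideal V \<Delta>"
    show "p \<in> rename_vars \<rho> ` face_ideal V' \<Delta>'"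
    proof (rule mpoly_induct[of p "\<lambda>m. Poly_Mapping.keys m \<subseteq> V \<and> Poly_Mapping.keys m \<notin> \<Delta>"])
      show "Poly_Mapping.keys m \<subseteq> V \<and> Poly_Mapping.keys m \<notin> \<Delta>" if "m \<in> Poly_Mapping.keys p" for m
        using p that by (simp add: face_ideal_def)
      show "0 \<in> rename_vars \<rho> ` face_ideal V' \<Delta>'"
        by (rule image_eqI[of _ _ 0]) (simp_all add: rename_vars_eq)
      fix m :: "'w \<Rightarrow>\<^sub>0 nat" and a :: 'a assume m: "Poly_Mapping.keys m \<subseteq> V \<and> Poly_Mapping.keys m \<notin> \<Delta>"
      then obtain \<sigma> where \<sigma>: "\<forall>w\<in>Poly_Mapping.keys m. \<rho> (\<sigma> w) = w"
        "\<sigma> ` Poly_Mapping.keys m \<subseteq> V'" "\<sigma> ` Poly_Mapping.keys m \<notin> \<Delta>'"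
        using lift by blast
      show "Poly_Mapping.single m a \<in> rename_vars \<rho> ` face_ideal V' \<Delta>'"
      proof (rule image_eqI)
        show "Poly_Mapping.single m a = rename_vars \<rho> (Poly_Mapping.single (rename_monom \<sigma> m) a)"
          using \<sigma>(1) by (simp add: rename_vars_eq linear_ext_single rename_monom_section)
        show "Poly_Mapping.single (rename_monom \<sigma> m) a \<in> face_ideal V' \<Delta>'"
          using \<sigma>(2,3) by (simp add: face_ideal_def keys_rename_monom)
      qed
    next
      fix p q :: "('w, 'a) mpoly" assume "p \<in> rename_vars \<rho> ` face_ideal V' \<Delta>'" "q \<in> rename_vars \<rho> ` face_ideal V' \<Delta>'"
      then show "p + q \<in> rename_vars \<rho> ` face_ideal V' \<Delta>'"
        unfolding rename_vars_eq by (auto simp: linear_ext_add[symmetric] intro!: imageI face_ideal_add)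
    qed
  qed
qed

lemma xpow_dvd_lookup_le:
  assumes "(xpow l :: ('v, 'a::comm_ring_1) mpoly) dvd xpow m"
  shows "Poly_Mapping.lookup l w \<le> Poly_Mapping.lookup m w"
proof -
  obtain q where q: "(xpow m :: ('v, 'a) mpoly) = xpow l * q" using assms by (rule dvdE)
  have "m \<in> Poly_Mapping.keys (xpow m :: ('v, 'a) mpoly)" by (simp add: xpow_def)
  then obtain t where "m = l + t" unfolding q using keys_mult[of "xpow l" q] by (auto simp: xpow_def)
  then show ?thesis by (simp add: lookup_add)
qed

lemma lookup_Var_mult:
  "Poly_Mapping.lookup (Var u * p) l =
    (if u \<in> Poly_Mapping.keys l then Poly_Mapping.lookup p (down u l) else (0 :: 'a::comm_ring_1))"
proof (rule mpoly_induct[of p "\<lambda>_. True"])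
  fix m and a :: 'a
  have "Poly_Mapping.single u 1 + m = l \<longleftrightarrow> u \<in> Poly_Mapping.keys l \<and> m = down u l"
    by (auto simp: poly_mapping_eq_iff fun_eq_iff lookup_add lookup_single lookup_down when_def in_keys_iff split: if_splits)
  then show "Poly_Mapping.lookup (Var u * Poly_Mapping.single m a) l =
      (if u \<in> Poly_Mapping.keys l then Poly_Mapping.lookup (Poly_Mapping.single m a) (down u l) else 0)"
    by (simp add: Var_def xpow_def mult_single lookup_single when_def)
qed (simp_all add: distrib_left lookup_add)

text \<open>The face \<open>G\<close> of \<open>\<Delta>\<close> not containing \<open>i\<close> with \<open>G \<union> {i} \<notin> \<Delta>\<close> carries a label
  \<open>lam G\<close>; in the nonface \<open>G \<union> {i}\<close> the vertex \<open>i\<close> is replaced by this label.\<close>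

definition split_vertex :: "'v \<Rightarrow> 'v set \<Rightarrow> 'v set set \<Rightarrow> ('v set \<Rightarrow> 'v) \<Rightarrow> 'v set \<Rightarrow> 'v set set" where
  "split_vertex i W \<Delta> lam Z =
    {F. F \<subseteq> W \<union> Z \<and> F \<inter> W \<in> \<Delta> \<and> (insert i (F \<inter> W) \<notin> \<Delta> \<longrightarrow> lam (F \<inter> W) \<notin> F)}"

definition labelling :: "'v \<Rightarrow> 'v set \<Rightarrow> 'v set set \<Rightarrow> ('v set \<Rightarrow> 'v) \<Rightarrow> 'v set \<Rightarrow> bool" where
  "labelling i W \<Delta> lam Z \<longleftrightarrow> finite Z \<and> Z \<inter> W = {} \<and> lam ` unjoined i \<Delta> \<subseteq> Z \<and>
    (\<forall>G\<in>unjoined i \<Delta>. \<forall>G'\<in>unjoined i \<Delta>. G \<subseteq> G' \<longrightarrow> lam G = lam G')"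

section \<open>Complexes with a split vertex\<close>

locale vertex_splitting = base: stanley_reisner K "insert i W" \<Delta>
  for K :: "'a::field itself" and i :: 'v and W :: "'v set" and \<Delta> :: "'v set set" +
  assumes i_notin: "i \<notin> W"
begin

abbreviation U :: "'v set set" where "U \<equiv> unjoined i \<Delta>"
abbreviation splt :: "('v set \<Rightarrow> 'v) \<Rightarrow> 'v set \<Rightarrow> 'v set set" where "splt \<equiv> split_vertex i W \<Delta>"
abbreviation lbl :: "('v set \<Rightarrow> 'v) \<Rightarrow> 'v set \<Rightarrow> bool" where "lbl \<equiv> labelling i W \<Delta>"

lemma U_subset_W: "G \<in> U \<Longrightarrow> G \<subseteq> W"
  using base.unjoinedD[of G i] by blast

lemma finite_W: "finite W"
  using base.finite_subset_V[of W] by blast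

lemma lblD:
  assumes "lbl lam Z"
  shows "finite Z" "Z \<inter> W = {}" "G \<in> U \<Longrightarrow> lam G \<in> Z"
    "G \<in> U \<Longrightarrow> G' \<in> U \<Longrightarrow> G \<subseteq> G' \<Longrightarrow> lam G = lam G'"
  using assms unfolding labelling_def by blast+

text \<open>There are two kinds of nonfaces: those whose part in W is a nonface of
  \<open>\<Delta>\<close>, and those treated here, which contain the label of their part in
  W.\<close>

lemma splt_nonface:
  assumes "F \<subseteq> W \<union> Z" "F \<notin> splt lam Z" "F \<inter> W \<in> \<Delta>"
  shows "F \<inter> W \<in> U" "lam (F \<inter> W) \<in> F"
  using assms by (auto simp: split_vertex_def unjoined_def)

lemma splt_face:
  assumes "F \<in> splt lam Z"
  shows "F \<inter> W \<in> \<Delta>" "F \<inter> W \<in> U \<Longrightarrow> lam (F \<inter> W) \<notin> F"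
  using assms by (auto simp: split_vertex_def unjoined_def)

lemma splt_nonfaceI: "F \<inter> W \<in> U \<Longrightarrow> lam (F \<inter> W) \<in> F \<Longrightarrow> F \<notin> splt lam Z"
  by (auto simp: split_vertex_def unjoined_def)

text \<open>If a subset \<open>G\<close> of a face \<open>F\<close> contained the label of
  \<open>G \<inter> W\<close>, then \<open>F \<inter> W\<close> would lie above
  \<open>G \<inter> W\<close> in the up-set \<open>U\<close> and carry the same label, which would
  be in \<open>F\<close>.\<close>

lemma splt_complex:
  assumes lam: "lbl lam Z"
  shows "simplicial_complex (W \<union> Z) (splt lam Z)"
  unfolding simplicial_complex_def
proof (intro conjI ballI allI impI)
  show "finite (W \<union> Z)" using finite_W lblD(1)[OF lam] by simp
  show "splt lam Z \<subseteq> Pow (W \<union> Z)" by (auto simp: split_vertex_def)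
  have "{} \<in> \<Delta>" using base.complex by (simp add: simplicial_complex_def)
  then show "{} \<in> splt lam Z" by (simp add: split_vertex_def)
  fix F G assume F: "F \<in> splt lam Z" and G: "G \<subseteq> F"
  have GW: "G \<inter> W \<in> \<Delta>" using splt_face(1)[OF F] base.face_mono[of "F \<inter> W" "G \<inter> W"] G by blast
  show "G \<in> splt lam Z"
  proof (rule ccontr)
    assume "G \<notin> splt lam Z"
    moreover have "G \<subseteq> W \<union> Z" using F G by (auto simp: split_vertex_def)
    ultimately have GU: "G \<inter> W \<in> U" and GG: "lam (G \<inter> W) \<in> G" using splt_nonface GW by blast+
    have sub: "G \<inter> W \<subseteq> F \<inter> W" using G by blast
    have FU: "F \<inter> W \<in> U" by (rule base.unjoined_mono[OF GU sub splt_face(1)[OF F]])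
    then have "lam (F \<inter> W) \<notin> F" by (rule splt_face(2)[OF F])
    then show False using lblD(4)[OF lam GU FU sub] GG G by auto
  qed
qed

text \<open>The start of the chain of separations: with the constant label \<open>i\<close> nothing
  is split.\<close>

lemma splt_trivial: "splt (\<lambda>_. i) {i} = \<Delta>"
proof (rule Set.set_eqI)
  fix F
  show "F \<in> splt (\<lambda>_. i) {i} \<longleftrightarrow> F \<in> \<Delta>"
  proof
    assume F: "F \<in> splt (\<lambda>_. i) {i}"
    then have sub: "F \<subseteq> insert i W" "F \<inter> W \<in> \<Delta>" by (auto simp: split_vertex_def)
    show "F \<in> \<Delta>"
    proof (cases "i \<in> F")
      case True
      then have "F = insert i (F \<inter> W)" using sub by blast
      then show ?thesis using F True by (auto simp: split_vertex_def)
    next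
      case False
      then have "F = F \<inter> W" using sub by blast
      then show ?thesis using sub by simp
    qed
  next
    assume F: "F \<in> \<Delta>"
    then have sub: "F \<subseteq> insert i W" using base.complex by (auto simp: simplicial_complex_def)
    have "F \<inter> W \<in> \<Delta>" "i \<in> F \<Longrightarrow> insert i (F \<inter> W) \<in> \<Delta>"
      using base.face_mono[OF F, of "F \<inter> W"] base.face_mono[OF F, of "insert i (F \<inter> W)"] by auto
    then show "F \<in> splt (\<lambda>_. i) {i}" using sub by (auto simp: split_vertex_def)
  qed
qed

text \<open>This serves both for a single separation, where y is sent to i, and for the closing
  renaming of i to the first new vertex.\<close>

lemma rename_splt:
  assumes lam: "lbl lam Z" and lam': "lbl lam' Z'"
    and \<rho>W: "\<And>w. w \<in> W \<Longrightarrow> \<rho> w = w" and \<rho>Z: "\<rho> ` Z' = Z"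
    and \<rho>lam: "\<And>G. G \<in> U \<Longrightarrow> lam G = \<rho> (lam' G)"
  shows "(face_ideal (W \<union> Z) (splt lam Z) :: ('v, 'a) mpoly set) =
    rename_vars \<rho> ` face_ideal (W \<union> Z') (splt lam' Z')"
proof (rule rename_vars_face_ideal)
  note disj = lblD(2)[OF lam] lblD(2)[OF lam']
  fix F assume F: "F \<subseteq> W \<union> Z'" "F \<notin> splt lam' Z'"
  have FW: "\<rho> ` F \<inter> W = F \<inter> W"
  proof (rule image_Int_fixed[OF \<rho>W])
    fix w assume "w \<in> F" "w \<notin> W"
    then have "\<rho> w \<in> Z" using F(1) \<rho>Z by blast
    then show "\<rho> w \<notin> W" using disj by blast
  qed
  have "\<rho> ` F \<subseteq> W \<union> Z" using F(1) \<rho>W \<rho>Z by auto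
  moreover have "\<rho> ` F \<notin> splt lam Z"
  proof
    assume *: "\<rho> ` F \<in> splt lam Z"
    then have "F \<inter> W \<in> \<Delta>" using splt_face(1) FW by metis
    then have "F \<inter> W \<in> U" "lam' (F \<inter> W) \<in> F" using splt_nonface F by blast+
    then show False using splt_face(2)[OF *] \<rho>lam[of "F \<inter> W"] by (simp add: FW)
  qed
  ultimately show "\<rho> ` F \<subseteq> W \<union> Z \<and> \<rho> ` F \<notin> splt lam Z" by blast
next
  note disj = lblD(2)[OF lam] lblD(2)[OF lam']
  fix F assume F: "F \<subseteq> W \<union> Z" "F \<notin> splt lam Z"
  \<comment> \<open>To keep the image of \<open>F\<close> a nonface, the label of
    \<open>F \<inter> W\<close> must go to the label that \<open>lam'\<close> assigns to it. The
    other vertices of Z may go to any preimage.\<close>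
  define \<sigma> where "\<sigma> w = (if w \<in> W then w else if F \<inter> W \<in> U \<and> w = lam (F \<inter> W) then lam' (F \<inter> W)
    else (SOME z. z \<in> Z' \<and> \<rho> z = w))" for w
  have \<sigma>Z: "\<sigma> w \<in> Z' \<and> \<rho> (\<sigma> w) = w" if w: "w \<in> Z" for w
  proof (cases "F \<inter> W \<in> U \<and> w = lam (F \<inter> W)")
    case True
    then show ?thesis using w disj lblD(3)[OF lam'] \<rho>lam[of "F \<inter> W"] by (auto simp: \<sigma>_def)
  next
    case False
    have "\<exists>z. z \<in> Z' \<and> \<rho> z = w" using w \<rho>Z by blast
    then have "(SOME z. z \<in> Z' \<and> \<rho> z = w) \<in> Z' \<and> \<rho> (SOME z. z \<in> Z' \<and> \<rho> z = w) = w" by (rule someI_ex)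
    then show ?thesis using False w disj by (auto simp: \<sigma>_def)
  qed
  have \<sigma>W: "\<sigma> w = w" if "w \<in> W" for w using that by (simp add: \<sigma>_def)
  have FW: "\<sigma> ` F \<inter> W = F \<inter> W"
  proof (rule image_Int_fixed[OF \<sigma>W])
    fix w assume "w \<in> F" "w \<notin> W"
    then have "\<sigma> w \<in> Z'" using F(1) \<sigma>Z by blast
    then show "\<sigma> w \<notin> W" using disj by blast
  qed
  have "\<forall>w\<in>F. \<rho> (\<sigma> w) = w" using F(1) \<sigma>W \<sigma>Z \<rho>W by auto
  moreover have "\<sigma> ` F \<subseteq> W \<union> Z'" using F(1) \<sigma>W \<sigma>Z by auto
  moreover have "\<sigma> ` F \<notin> splt lam' Z'"
  proof
    assume *: "\<sigma> ` F \<in> splt lam' Z'"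
    then have "F \<inter> W \<in> \<Delta>" using splt_face(1) FW by metis
    then have FU: "F \<inter> W \<in> U" "lam (F \<inter> W) \<in> F" using splt_nonface F by blast+
    then have "lam (F \<inter> W) \<notin> W" using lblD(3)[OF lam] disj by blast
    then have "\<sigma> (lam (F \<inter> W)) = lam' (F \<inter> W)" using FU by (simp add: \<sigma>_def)
    then have "lam' (F \<inter> W) \<in> \<sigma> ` F" using FU(2) by (metis imageI)
    then show False using splt_face(2)[OF *] FU(1) by (simp add: FW)
  qed
  ultimately show "\<exists>\<sigma>. (\<forall>w\<in>F. \<rho> (\<sigma> w) = w) \<and> \<sigma> ` F \<subseteq> W \<union> Z' \<and> \<sigma> ` F \<notin> splt lam' Z'" by blast
qed

text \<open>Take \<open>G\<close> of least cardinality among the faces labelled \<open>z\<close>. A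
  divisor of the monomial of \<open>G\<close> with \<open>z\<close> that lies in the ideal has its
  part in W inside \<open>G\<close>, hence a face, hence in \<open>U\<close> with the same label; by
  minimality this part is \<open>G\<close>, and the label has to occur as well.\<close>

lemma minimal_generator_splt:
  assumes lam: "lbl lam Z" and z: "z \<in> lam ` U"
  shows "\<exists>f\<in>minimal_generators (face_ideal (W \<union> Z) (splt lam Z) :: ('v, 'a) mpoly set). Var z dvd f"
proof -
  let ?I = "face_ideal (W \<union> Z) (splt lam Z) :: ('v, 'a) mpoly set"
  define P where "P G \<longleftrightarrow> G \<in> U \<and> lam G = z" for G
  obtain G0 where "P G0" using z by (auto simp: P_def)
  then obtain G where G: "P G" and least: "\<And>G'. P G' \<Longrightarrow> card G \<le> card G'"
    using ex_has_least_nat[of P G0 card] by blast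
  have GU: "G \<in> U" and lamG: "lam G = z" using G by (auto simp: P_def)
  have GW: "G \<subseteq> W" and finG: "finite G" using U_subset_W[OF GU] base.unjoinedD(5)[OF GU] by auto
  have zZ: "z \<in> Z" "z \<notin> W" using lblD(2,3)[OF lam] GU lamG by auto
  let ?f = "xpow (sqf (insert z G)) :: ('v, 'a) mpoly"
  have NW: "insert z G \<inter> W = G" using GW zZ by blast
  have "insert z G \<notin> splt lam Z" by (rule splt_nonfaceI) (simp_all only: NW GU lamG insertI1)
  then have fI: "?f \<in> ?I" using GW zZ finG by (auto simp: xpow_in_face_ideal)
  have "g = ?f" if g: "g \<in> ?I" "g \<in> range xpow" "g dvd ?f" for g
  proof -
    obtain l where l: "g = xpow l" using g(2) by blast
    let ?F = "Poly_Mapping.keys l"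
    have F: "?F \<subseteq> W \<union> Z" "?F \<notin> splt lam Z" using g(1) by (auto simp: l xpow_in_face_ideal)
    have le: "Poly_Mapping.lookup l w \<le> Poly_Mapping.lookup (sqf (insert z G)) w" for w
      using g(3) unfolding l by (rule xpow_dvd_lookup_le)
    have sub: "?F \<subseteq> insert z G"
    proof
      fix w assume "w \<in> ?F"
      then show "w \<in> insert z G" using le[of w] finG by (auto simp: in_keys_iff lookup_sqf split: if_splits)
    qed
    have FG: "?F \<inter> W \<subseteq> G" using sub zZ by blast
    then have "?F \<inter> W \<in> \<Delta>" using base.face_mono base.unjoinedD(1)[OF GU] by blast
    then have FU: "?F \<inter> W \<in> U" and lamF: "lam (?F \<inter> W) \<in> ?F" using splt_nonface F by blast+
    have "P (?F \<inter> W)" using lblD(4)[OF lam FU GU FG] FU lamG by (simp add: P_def)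
    then have "?F \<inter> W = G" using least FG finG by (meson card_seteq)
    then have "?F = insert z G" using sub lamF lamG by auto
    then have nz: "Poly_Mapping.lookup l w \<noteq> 0 \<longleftrightarrow> w \<in> insert z G" for w
      using in_keys_iff[of w l] by simp
    have "Poly_Mapping.lookup l w = Poly_Mapping.lookup (sqf (insert z G)) w" for w
      using le[of w] nz[of w] finG by (cases "w \<in> insert z G") (simp_all only: lookup_sqf finite_insert if_True if_False, auto)
    then have "l = sqf (insert z G)" by (rule poly_mapping_eqI)
    then show ?thesis by (simp add: l)
  qed
  then have "?f \<in> minimal_generators ?I" using fI by (auto simp: minimal_generators_def)
  moreover have "z \<notin> G" using GW zZ by blast
  then have "sqf (insert z G) = Poly_Mapping.single z 1 + sqf G" using finG by (simp add: sqf_def)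
  then have "Var z dvd ?f" by (simp only: Var_def xpow_add dvd_triv_left)
  ultimately show ?thesis by blast
qed

text \<open>Let \<open>(y - x\<^sub>i) p\<close> be in the ideal and let \<open>x\<^sup>m\<close> be a monomial of \<open>p\<close> outside the ideal
  of maximal degree in \<open>y\<close>. Then \<open>y x\<^sup>m\<close> is in the ideal, which forces the degree in \<open>y\<close> to be \<open>0\<close>;
  hence \<open>x\<^sub>i x\<^sup>m\<close> is in the ideal as well, but \<open>x\<^sup>m\<close> determines the label.\<close>

lemma splt_nonzerodivisor:
  fixes p :: "('v, 'a) mpoly"
  assumes lam: "lbl lam Z" and yi: "y \<noteq> i" "y \<in> Z" "i \<in> Z"
    and p: "p \<in> carrier (poly_ring (W \<union> Z))"
    and prod: "(Var y - Var i) * p \<in> face_ideal (W \<union> Z) (splt lam Z)"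
  shows "p \<in> face_ideal (W \<union> Z) (splt lam Z)"
proof (rule ccontr)
  assume notin: "p \<notin> face_ideal (W \<union> Z) (splt lam Z)"
  define M where "M = {m \<in> Poly_Mapping.keys p. Poly_Mapping.keys m \<in> splt lam Z}"
  have "finite M" by (simp add: M_def)
  moreover have "M \<noteq> {}" using notin p by (auto simp: M_def face_ideal_def carrier_poly_ring)
  ultimately have "Max ((\<lambda>m. Poly_Mapping.lookup m y) ` M) \<in> (\<lambda>m. Poly_Mapping.lookup m y) ` M"
    by (intro Max_in) auto
  then obtain m where m: "m \<in> M" and m_Max: "Poly_Mapping.lookup m y = Max ((\<lambda>m. Poly_Mapping.lookup m y) ` M)"
    by auto
  have max: "Poly_Mapping.lookup l y \<le> Poly_Mapping.lookup m y" if "l \<in> M" for l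
    using that \<open>finite M\<close> by (simp add: m_Max)
  have face: "Poly_Mapping.keys m \<in> splt lam Z" and mp: "Poly_Mapping.lookup p m \<noteq> 0"
    using m by (auto simp: M_def in_keys_iff)
  have mV: "Poly_Mapping.keys m \<subseteq> W \<union> Z" using face by (auto simp: split_vertex_def)
  have coeff: "Poly_Mapping.lookup ((Var y - Var i) * p) l =
      (if y \<in> Poly_Mapping.keys l then Poly_Mapping.lookup p (down y l) else 0) -
      (if i \<in> Poly_Mapping.keys l then Poly_Mapping.lookup p (down i l) else 0)" for l
    by (simp add: left_diff_distrib lookup_minus lookup_Var_mult)
  define up where "up u = m + Poly_Mapping.single u 1" for u
  have keys_up: "Poly_Mapping.keys (up u) = insert u (Poly_Mapping.keys m)" for u
    by (simp add: up_def keys_add_nat)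
  have down_up: "down u (up u) = m" for u
    by (rule poly_mapping_eqI) (simp add: up_def lookup_down lookup_add lookup_single when_def)
  have label: "Poly_Mapping.keys m \<inter> W \<in> U \<and> lam (Poly_Mapping.keys m \<inter> W) = u \<and> u \<notin> Poly_Mapping.keys m"
    if u: "u \<in> Z" and "insert u (Poly_Mapping.keys m) \<notin> splt lam Z" for u
  proof -
    have uW: "insert u (Poly_Mapping.keys m) \<inter> W = Poly_Mapping.keys m \<inter> W"
      using u lblD(2)[OF lam] by blast
    then have "Poly_Mapping.keys m \<inter> W \<in> U" "lam (Poly_Mapping.keys m \<inter> W) \<in> insert u (Poly_Mapping.keys m)"
      using splt_nonface[of "insert u (Poly_Mapping.keys m)" Z lam] that mV splt_face(1)[OF face] by auto
    then show ?thesis using splt_face(2)[OF face] by auto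
  qed
  have "insert y (Poly_Mapping.keys m) \<notin> splt lam Z"
  proof
    let ?l = "up y"
    assume l: "insert y (Poly_Mapping.keys m) \<in> splt lam Z"
    then have "?l \<notin> Poly_Mapping.keys ((Var y - Var i) * p)"
      using prod keys_up[of y] by (auto simp: face_ideal_def)
    then have "Poly_Mapping.lookup ((Var y - Var i) * p) ?l = 0" by (simp add: in_keys_iff)
    \<comment> \<open>The coefficient at \<open>up y\<close> vanishes, so the contribution of
      \<open>m\<close> is cancelled by i times the monomial \<open>down i (up y)\<close>. That
      monomial is supported on a face and has a larger exponent at y than \<open>m\<close>, against
      maximality.\<close>
    then have i: "i \<in> Poly_Mapping.keys ?l" and nz: "Poly_Mapping.lookup p (down i ?l) \<noteq> 0"
      using mp by (auto simp: coeff keys_up down_up split: if_splits)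
    have "Poly_Mapping.keys (down i ?l) \<subseteq> insert y (Poly_Mapping.keys m)"
      using keys_down_subset[of i ?l] keys_up by blast
    then have "Poly_Mapping.keys (down i ?l) \<in> splt lam Z"
      using l splt_complex[OF lam] by (auto simp: simplicial_complex_def)
    then have "down i ?l \<in> M" using nz by (simp add: M_def in_keys_iff)
    from max[OF this] yi show False by (simp add: up_def lookup_down lookup_add)
  qed
  from label[OF yi(2) this] have y: "lam (Poly_Mapping.keys m \<inter> W) = y" "y \<notin> Poly_Mapping.keys m" by blast+
  have "insert i (Poly_Mapping.keys m) \<notin> splt lam Z"
  proof -
    let ?l = "up i"
    \<comment> \<open>The vertex y does not occur in \<open>up i\<close>, so nothing can cancel the
      contribution of \<open>m\<close>.\<close>
    have "Poly_Mapping.lookup ((Var y - Var i) * p) ?l \<noteq> 0"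
      using mp y(2) yi(1) by (simp add: coeff keys_up down_up)
    then have "?l \<in> Poly_Mapping.keys ((Var y - Var i) * p)" by (simp add: in_keys_iff)
    then show ?thesis using prod keys_up[of i] by (auto simp: face_ideal_def)
  qed
  from label[OF yi(3) this] show False using y yi(1) by auto
qed

text \<open>Both ideals come from the same \<open>\<Delta>\<close>; \<open>lam'\<close> refines
  \<open>lam\<close> by moving some faces from the label i to the new label y. That both labels are
  attained supplies minimal generators divisible by either variable.\<close>

lemma is_separation_splt:
  assumes lam: "lbl lam Z" and lam': "lbl lam' (insert y Z)" and y: "y \<notin> Z" "y \<in> lam' ` U"
    and i: "i \<in> Z" "i \<in> lam' ` U"
    and lam_eq: "\<And>G. G \<in> U \<Longrightarrow> lam G = (id(y := i)) (lam' G)"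
  shows "is_separation (W \<union> Z) i y (face_ideal (W \<union> Z) (splt lam Z) :: ('v, 'a) mpoly set)
    (face_ideal (W \<union> insert y Z) (splt lam' (insert y Z)))"
proof -
  let ?V = "W \<union> insert y Z"
  let ?J = "face_ideal ?V (splt lam' (insert y Z)) :: ('v, 'a) mpoly set"
  have yW: "y \<notin> W" using lblD(2)[OF lam'] by blast
  have V: "insert y (W \<union> Z) = ?V" by blast
  interpret J: stanley_reisner K ?V "splt lam' (insert y Z)"
    by unfold_locales (rule splt_complex[OF lam'])
  have yi: "Var y - Var i \<in> carrier J.S"
    using i(1) by (intro J.carrier_diff) (auto simp: Var_def intro!: xpow_in_poly_ring)
  have nzd: "q = \<zero>\<^bsub>J.Q\<^esub>" if q: "q \<in> carrier J.Q" and "J.cls (Var y - Var i) \<otimes>\<^bsub>J.Q\<^esub> q = \<zero>\<^bsub>J.Q\<^esub>" for q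
  proof -
    obtain p where p: "p \<in> carrier J.S" "q = J.cls p" using q unfolding J.carrier_Q by blast
    have "J.cls ((Var y - Var i) * p) = \<zero>\<^bsub>J.Q\<^esub>"
      using that(2) unfolding p(2) J.cls_mult[OF yi p(1)] .
    then have "(Var y - Var i) * p \<in> ?J" unfolding J.cls_zero_iff[OF J.carrier_mult[OF yi p(1)]] .
    moreover have "y \<noteq> i" using y i by blast
    ultimately have "p \<in> ?J" using splt_nonzerodivisor[OF lam'] p i(1) by blast
    then show ?thesis unfolding p(2) by (rule J.cls_ideal)
  qed
  have image: "id(y := i) ` insert y Z = Z" using y i by (auto simp: image_iff)
  show ?thesis
    unfolding is_separation_def V Let_def
  proof (intro conjI ballI impI)
    show "squarefree_monomial_ideal (W \<union> Z) (face_ideal (W \<union> Z) (splt lam Z) :: ('v, 'a) mpoly set)"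
      by (rule squarefree_face_ideal[OF splt_complex[OF lam]])
    show "monomial_ideal ?V ?J" by (rule monomial_face_ideal[OF splt_complex[OF lam']])
    show "face_ideal (W \<union> Z) (splt lam Z) = rename_vars (id(y := i)) ` ?J"
      by (rule rename_splt[OF lam lam' _ image lam_eq]) (use yW in auto)
    show "\<exists>f\<in>minimal_generators ?J. Var i dvd f" by (rule minimal_generator_splt[OF lam' i(2)])
    show "\<exists>f\<in>minimal_generators ?J. Var y dvd f" by (rule minimal_generator_splt[OF lam' y(2)])
  qed (use y yW i nzd in auto)
qed

text \<open>Deleting the vertices outside W moves a face down to a comparable one in the same poset,
  and what remains are exactly the members of \<open>U\<close> labelled u. The components at u are
  therefore those of this part of \<open>U\<close>.\<close>

lemma unjoined_splt:
  assumes lam: "lbl lam Z" and u: "u \<in> Z"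
  shows "G \<in> unjoined u (splt lam Z) \<Longrightarrow>
      G \<inter> W \<in> U \<and> lam (G \<inter> W) = u \<and> G \<inter> W \<in> unjoined u (splt lam Z)"
    and "G \<in> U \<Longrightarrow> lam G = u \<Longrightarrow> G \<in> unjoined u (splt lam Z)"
proof -
  have uW: "u \<notin> W" using u lblD(2)[OF lam] by blast
  show *: "G \<in> unjoined u (splt lam Z)" if G: "G \<in> U" "lam G = u" for G
  proof -
    have GW: "G \<inter> W = G" "insert u G \<inter> W = G" using U_subset_W[OF G(1)] uW by auto
    have "insert u G \<notin> splt lam Z" using G GW by (intro splt_nonfaceI) auto
    moreover have "G \<in> splt lam Z"
      using G GW base.unjoinedD[OF G(1)] uW U_subset_W[OF G(1)] by (auto simp: split_vertex_def)
    ultimately show ?thesis by (simp add: unjoined_def)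
  qed
  assume "G \<in> unjoined u (splt lam Z)"
  then have G: "G \<in> splt lam Z" "insert u G \<notin> splt lam Z" by (auto simp: unjoined_def)
  have uGW: "insert u G \<inter> W = G \<inter> W" using uW by blast
  have "insert u G \<subseteq> W \<union> Z" using G(1) u by (auto simp: split_vertex_def)
  then have "G \<inter> W \<in> U" "lam (G \<inter> W) \<in> insert u G"
    using splt_nonface[OF _ G(2)] splt_face(1)[OF G(1)] unfolding uGW by blast+
  then have "G \<inter> W \<in> U" "lam (G \<inter> W) = u" using splt_face(2)[OF G(1)] by auto
  then show "G \<inter> W \<in> U \<and> lam (G \<inter> W) = u \<and> G \<inter> W \<in> unjoined u (splt lam Z)" using * by blast
qed

text \<open>The hypothesis \<open>const\<close> says that each label belongs to a single component,
  which settles unit vectors. In degree zero the homomorphism is zero. Any other b exceeds somewhere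
  the exponents of the monomials of suitable nonfaces, so again only zero is possible.\<close>

lemma T1_splt_trivial:
  assumes lam: "lbl lam Z"
    and const: "\<And>(c :: 'v set \<Rightarrow> 'a) G G'. locally_constant U c \<Longrightarrow> G \<in> U \<Longrightarrow> G' \<in> U \<Longrightarrow> lam G = lam G' \<Longrightarrow> c G = c G'"
    and b: "\<And>w. 0 \<le> Poly_Mapping.lookup b w" "Poly_Mapping.keys b \<subseteq> Z"
  shows "Hom_homog (W \<union> Z) (face_ideal (W \<union> Z) (splt lam Z) :: ('v, 'a) mpoly set) (- b)
    \<subseteq> delta (W \<union> Z) (face_ideal (W \<union> Z) (splt lam Z)) ` derivations (W \<union> Z)"
proof -
  interpret J: stanley_reisner K "W \<union> Z" "splt lam Z"
    by unfold_locales (rule splt_complex[OF lam])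
  have zeroI: "\<phi> \<in> J.trivial" if \<phi>: "\<phi> \<in> Hom_quot (W \<union> Z) J.I"
    and vanish: "\<And>F. F \<subseteq> W \<union> Z \<Longrightarrow> F \<notin> splt lam Z \<Longrightarrow>
      \<exists>N\<subseteq>F. N \<notin> splt lam Z \<and> \<phi> (xpow (sqf N)) = \<zero>\<^bsub>J.Q\<^esub>" for \<phi>
  proof -
    have "\<phi> = \<zero>\<^bsub>J.H\<^esub>"
    proof (rule J.Hom_quot_eqI[OF \<phi> J.Hom_zero_closed])
      fix F assume "F \<subseteq> W \<union> Z" "F \<notin> splt lam Z"
      from vanish[OF this] obtain N
        where N: "N \<subseteq> F" "N \<notin> splt lam Z" "\<phi> (xpow (sqf N)) = \<zero>\<^bsub>J.Q\<^esub>" by (elim exE conjE)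
      then have "N \<subseteq> W \<union> Z" using \<open>F \<subseteq> W \<union> Z\<close> by blast
      then have "xpow (sqf N) \<in> J.I" using N J.finite_subset_V by (simp add: xpow_in_face_ideal)
      then have "\<zero>\<^bsub>J.H\<^esub> (xpow (sqf N)) = \<zero>\<^bsub>J.Q\<^esub>" by (simp add: J.zero_H)
      then show "\<exists>N\<subseteq>F. N \<notin> splt lam Z \<and> \<phi> (xpow (sqf N)) = \<zero>\<^bsub>J.H\<^esub> (xpow (sqf N))" using N by metis
    qed
    then show ?thesis using J.trivial_zero_closed by simp
  qed
  have nonface_in_I: "xpow (sqf F) \<in> J.I" if "F \<subseteq> W \<union> Z" "F \<notin> splt lam Z" for F
    using that J.finite_subset_V by (simp add: xpow_in_face_ideal)
  consider "b = 0" | u where "b = Poly_Mapping.single u 1" | "b \<noteq> 0" "\<And>u. b \<noteq> Poly_Mapping.single u 1" by blast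
  then show ?thesis
  proof cases
    case 1
    show ?thesis
    proof
      fix \<phi> assume "\<phi> \<in> Hom_homog (W \<union> Z) J.I (- b)"
      then have \<phi>: "\<phi> \<in> Hom_homog (W \<union> Z) J.I 0" by (simp add: 1)
      show "\<phi> \<in> J.trivial"
        using J.Hom_homog_degree_zero[OF \<phi> nonface_in_I] by (intro zeroI J.Hom_homogD(1)[OF \<phi>]) blast
    qed
  next
    case (2 u)
    then have u: "u \<in> Z" using b(2) by simp
    note unj = unjoined_splt[OF lam u]
    show ?thesis unfolding 2
    proof (rule J.T1_unit_trivialI)
      show "u \<in> W \<union> Z" using u by simp
      fix c :: "'v set \<Rightarrow> 'a" and G G'
      assume c: "locally_constant (unjoined u (splt lam Z)) c"
        and G: "G \<in> unjoined u (splt lam Z)" and G': "G' \<in> unjoined u (splt lam Z)"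
      \<comment> \<open>Extension of \<open>c\<close> by zero to faces with other labels; comparable
        faces share their label, so the extension is locally constant on all of
        \<open>U\<close>.\<close>
      define c' where "c' F = (if lam F = u then c F else 0)" for F
      have "locally_constant U c'"
        unfolding locally_constant_def
      proof (intro ballI impI)
        fix F F' assume F: "F \<in> U" "F' \<in> U" "F \<subseteq> F'"
        then have "lam F = lam F'" by (rule lblD(4)[OF lam])
        show "c' F = c' F'"
        proof (cases "lam F = u")
          case True
          then have "c F = c F'" using F \<open>lam F = lam F'\<close> by (intro locally_constantD[OF c] unj(2)) simp_all
          then show ?thesis using \<open>lam F = lam F'\<close> by (simp add: c'_def)
        next
          case False
          then show ?thesis using \<open>lam F = lam F'\<close> by (simp add: c'_def)
        qed
      qed
      then have "c' (G \<inter> W) = c' (G' \<inter> W)" by (rule const) (use unj(1)[OF G] unj(1)[OF G'] in simp_all)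
      then have "c (G \<inter> W) = c (G' \<inter> W)" using unj(1)[OF G] unj(1)[OF G'] by (simp add: c'_def)
      \<comment> \<open>\<open>G \<inter> W\<close> lies below \<open>G\<close> in the same
        poset.\<close>
      moreover have "c (G \<inter> W) = c G" "c (G' \<inter> W) = c G'"
        using locally_constantD[OF c] unj(1)[OF G] unj(1)[OF G'] G G' by blast+
      ultimately show "c G = c G'" by simp
    qed
  next
    case 3
    show ?thesis
    proof
      fix \<phi> assume \<phi>: "\<phi> \<in> Hom_homog (W \<union> Z) J.I (- b)"
      show "\<phi> \<in> J.trivial"
      proof (rule zeroI[OF J.Hom_homogD(1)[OF \<phi>]])
        fix F assume F: "F \<subseteq> W \<union> Z" "F \<notin> splt lam Z"
        \<comment> \<open>Either \<open>F \<inter> W\<close> is already a nonface, or adding its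
          label makes it one; both involve at most one vertex of Z.\<close>
        have "\<exists>N\<subseteq>F. N \<notin> splt lam Z \<and> (\<exists>z. N \<inter> Z \<subseteq> {z})"
        proof (cases "F \<inter> W \<in> \<Delta>")
          case True
          let ?N = "insert (lam (F \<inter> W)) (F \<inter> W)"
          have FU: "F \<inter> W \<in> U" "lam (F \<inter> W) \<in> F" using splt_nonface F True by blast+
          have NW: "?N \<inter> W = F \<inter> W" using lblD(2,3)[OF lam] FU by blast
          then have "?N \<notin> splt lam Z" using FU by (intro splt_nonfaceI) auto
          moreover have "?N \<inter> Z \<subseteq> {lam (F \<inter> W)}" using lblD(2)[OF lam] by blast
          moreover have "?N \<subseteq> F" using FU(2) by blast
          ultimately show ?thesis by (intro exI[of _ ?N] exI[of _ "lam (F \<inter> W)"] conjI)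
        next
          case False
          then have "F \<inter> W \<notin> splt lam Z" by (auto simp: split_vertex_def)
          \<comment> \<open>This intersection is empty, so an arbitrary element will do as
            bound.\<close>
          moreover have "F \<inter> W \<inter> Z \<subseteq> {undefined}" using lblD(2)[OF lam] by blast
          ultimately show ?thesis by (intro exI[of _ "F \<inter> W"] exI[of _ undefined] conjI) simp_all
        qed
        then obtain N z where N: "N \<subseteq> F" "N \<notin> splt lam Z" "N \<inter> Z \<subseteq> {z}" by (elim exE conjE)
        have finN: "finite N" using N F J.finite_subset_V by blast
        have "\<exists>w. int (Poly_Mapping.lookup (sqf N) w) < Poly_Mapping.lookup b w"
        proof (rule ccontr)
          assume "\<nexists>w. int (Poly_Mapping.lookup (sqf N) w) < Poly_Mapping.lookup b w"
          then have le: "Poly_Mapping.lookup b w \<le> int (Poly_Mapping.lookup (sqf N) w)" for w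
            by (simp add: not_less)
          \<comment> \<open>A vector below the exponents of \<open>N\<close> and supported in Z has
            all its nonzero entries equal to 1 and located at the single vertex z, so a nonzero one
            is a unit vector, which is excluded.\<close>
          have keys_b: "w \<in> N \<inter> Z \<and> Poly_Mapping.lookup b w = 1" if "w \<in> Poly_Mapping.keys b" for w
            using that le[of w] b(1)[of w] b(2) finN by (auto simp: lookup_sqf in_keys_iff split: if_splits)
          obtain w where "w \<in> Poly_Mapping.keys b" using 3(1) by (metis keys_eq_empty all_not_in_conv)
          then have "b = Poly_Mapping.single w 1"
            using keys_b N(3) by (intro poly_mapping_eqI) (auto simp: lookup_single when_def in_keys_iff)
          then show False using 3(2) by blast
        qed
        then obtain w where "int (Poly_Mapping.lookup (sqf N) w) < Poly_Mapping.lookup b w" by blast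
        then have "\<phi> (xpow (sqf N)) = \<zero>\<^bsub>J.Q\<^esub>"
          using J.Hom_homog_small[OF \<phi> nonface_in_I[of N]] N F by blast
        then show "\<exists>N\<subseteq>F. N \<notin> splt lam Z \<and> \<phi> (xpow (sqf N)) = \<zero>\<^bsub>J.Q\<^esub>" using N by blast
      qed
    qed
  qed
qed

end

section \<open>The chain of separations, one component at a time\<close>

theorem proposition1p9:
  fixes K :: "'a::field itself" and n i k :: nat
    and \<Delta> :: "nat set set" and v :: "nat \<Rightarrow> nat"
  assumes "simplicial_complex {1..n} \<Delta>"
    and "i \<in> {1..n}"
    and "has_dim (T1_homog {1..n} (SR_ideal K {1..n} \<Delta>) (- Poly_Mapping.single i 1)) k"
    and "inj_on v {0..k}"
    and "v ` {0..k} \<inter> {1..n} = {}"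
  shows "\<exists>\<Delta>'. simplicial_complex (({1..n} - {i}) \<union> v ` {0..k}) \<Delta>' \<and>
           successive_separations {1..n} i k v
             (SR_ideal K {1..n} \<Delta>)
             (SR_ideal K (({1..n} - {i}) \<union> v ` {0..k}) \<Delta>') \<and>
           (\<forall>b :: nat \<Rightarrow>\<^sub>0 int. (\<forall>w. 0 \<le> Poly_Mapping.lookup b w) \<and> Poly_Mapping.keys b \<subseteq> v ` {0..k} \<longrightarrow>
              (let T = T1_homog (({1..n} - {i}) \<union> v ` {0..k})
                         (SR_ideal K (({1..n} - {i}) \<union> v ` {0..k}) \<Delta>') (- b)
               in carrier T = {\<zero>\<^bsub>T\<^esub>}))"
proof -
  define W where "W = {1..n} - {i}"
  have V: "{1..n} = insert i W" using assms(2) by (auto simp: W_def)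
  have iW: "i \<notin> W" by (simp add: W_def)
  note complex = assms(1)[unfolded V]
  interpret vertex_splitting K i W \<Delta> by unfold_locales (rule complex, rule iW)
  have "U \<subseteq> Pow W" using U_subset_W by blast
  then have "finite U" using finite_W by (meson finite_Pow_iff finite_subset)
  obtain cmp :: "nat set \<Rightarrow> nat" and r where cmp: "cmp ` U = {..<r}"
    and cmp_sub: "\<And>G G'. G \<in> U \<Longrightarrow> G' \<in> U \<Longrightarrow> G \<subseteq> G' \<Longrightarrow> cmp G = cmp G'"
    and cmp_const: "\<And>(c :: nat set \<Rightarrow> 'a) G G'. locally_constant U c \<Longrightarrow> G \<in> U \<Longrightarrow> G' \<in> U \<Longrightarrow>
      cmp G = cmp G' \<Longrightarrow> c G = c G'"
  proof (rule components_exist[OF \<open>finite U\<close>, where ?'a = 'a])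
    fix cmp :: "nat set \<Rightarrow> nat" and r
    assume *: "cmp ` U = {..<r}"
      "\<And>G G'. G \<in> U \<Longrightarrow> G' \<in> U \<Longrightarrow> G \<subseteq> G' \<Longrightarrow> cmp G = cmp G'"
      "\<And>(c :: nat set \<Rightarrow> 'a) G G'. locally_constant U c \<Longrightarrow> G \<in> U \<Longrightarrow> G' \<in> U \<Longrightarrow>
        cmp G = cmp G' \<Longrightarrow> c G = c G'"
    show thesis by (rule that[OF *])
  qed
  have SR: "SR_ideal K (insert i W) \<Delta> = face_ideal (insert i W) \<Delta>" by (rule SR_ideal_eq[OF complex])
  have "has_dim (T1_homog (insert i W) (face_ideal (insert i W) \<Delta> :: (nat, 'a) mpoly set)
      (- Poly_Mapping.single i 1)) (r - 1)"
    by (rule base.has_dim_T1_unit[OF _ cmp cmp_sub cmp_const]) simp_all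
  \<comment> \<open>The subtraction is truncated: k = 0 covers both one component and none, and in
    either case no separation takes place.\<close>
  then have k: "k = r - 1" using assms(3) unfolding V SR has_dim_def by (elim conjE) (rule trans[OF sym])
  have cmp_le: "cmp G \<le> k" if "G \<in> U" for G
  proof -
    have "cmp G < r" using cmp that by blast
    then show ?thesis by (simp add: k)
  qed
  have v_notin: "v j \<notin> W" "v j \<noteq> i" if "j \<le> k" for j
  proof -
    have "v j \<in> v ` {0..k}" using that by simp
    then have "v j \<notin> insert i W" using assms(5)[unfolded V] by blast
    then show "v j \<notin> W" "v j \<noteq> i" by auto
  qed
  have v_inj: "v j = v l \<longleftrightarrow> j = l" if "j \<le> k" "l \<le> k" for j l
    using assms(4) that by (simp add: inj_on_eq_iff)

  \<comment> \<open>After j separations the components 1 to j carry their new variables, while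
    component 0 and the components above j still sit at i.\<close>
  define lam where "lam j G = (if 1 \<le> cmp G \<and> cmp G \<le> j then v (cmp G) else i)" for j G
  define Z where "Z j = insert i (v ` {1..j})" for j
  define J where "J j = (face_ideal (W \<union> Z j) (splt (lam j) (Z j)) :: (nat, 'a) mpoly set)" for j
  have WZ: "insert i W \<union> v ` {1..j} = W \<union> Z j" for j by (auto simp: Z_def)
  have lam: "lbl (lam j) (Z j)" if "j \<le> k" for j
    unfolding labelling_def
  proof (intro conjI ballI impI)
    show "Z j \<inter> W = {}" using that v_notin iW by (auto simp: Z_def)
    fix G G' assume "G \<in> U" "G' \<in> U" "G \<subseteq> G'"
    from cmp_sub[OF this] show "lam j G = lam j G'" by (simp add: lam_def)
  qed (auto simp: Z_def lam_def)
  have J0: "J 0 = SR_ideal K (insert i W) \<Delta>"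
  proof -
    have "lam 0 = (\<lambda>_. i)" by (rule ext) (simp add: lam_def)
    then show ?thesis by (simp add: J_def SR Z_def splt_trivial)
  qed
  have step: "is_separation (insert i W \<union> v ` {1..j - 1}) i (v j) (J (j - 1)) (J j)" if j: "j \<in> {1..k}" for j
  proof -
    have Zj: "Z j = insert (v j) (Z (j - 1))"
      using j by (cases j) (auto simp: Z_def atLeastAtMostSuc_conv)
    \<comment> \<open>Some j in this range exists only if k is positive, so r = k + 1 and both
      components are inhabited. Component j provides a generator with the new variable, component 0
      one with that of i.\<close>
    have "j \<in> cmp ` U" "0 \<in> cmp ` U" using j by (auto simp: cmp k)
    then have y: "v j \<in> lam j ` U" and i: "i \<in> lam j ` U" using j by (force simp: lam_def)+
    have "v j \<notin> Z (j - 1)" using j v_notin v_inj by (auto simp: Z_def)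
    moreover have "lam (j - 1) G = (id(v j := i)) (lam j G)" if "G \<in> U" for G
      using j v_notin v_inj[of "cmp G" j] cmp_le[OF that] by (auto simp: lam_def)
    ultimately show ?thesis
      unfolding WZ J_def Zj
      using j lam[of "j - 1"] lam[of j] y i
      by (intro is_separation_splt) (auto simp: Zj, simp add: Z_def)
  qed
  \<comment> \<open>Compared with \<open>lam k\<close>, only component 0 changes its label, from i
    to \<open>v 0\<close>.\<close>
  define L where "L G = v (cmp G)" for G
  define X where "X = v ` {0..k}"
  have L: "lbl L X"
    unfolding labelling_def
  proof (intro conjI ballI impI)
    show "X \<inter> W = {}" using v_notin by (auto simp: X_def)
    show "L ` U \<subseteq> X" using cmp_le by (auto simp: L_def X_def)
    fix G G' assume "G \<in> U" "G' \<in> U" "G \<subseteq> G'"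
    from cmp_sub[OF this] show "L G = L G'" by (simp add: L_def)
  qed (simp add: X_def)
  let ?\<Delta>' = "splt L X"
  have SR': "SR_ideal K (W \<union> X) ?\<Delta>' = face_ideal (W \<union> X) ?\<Delta>'" by (rule SR_ideal_eq[OF splt_complex[OF L]])
  have "{0..k} = insert 0 {1..k}" by auto
  then have "X = insert (v 0) (v ` {1..k})" by (simp add: X_def)
  then have image: "id(i := v 0) ` Z k = X" using v_notin(2) by (force simp: Z_def)
  have last: "SR_ideal K (W \<union> X) ?\<Delta>' = rename_vars (id(i := v 0)) ` J k"
    unfolding SR' J_def
  proof (rule rename_splt[OF L lam[OF order_refl] _ image])
    fix G assume "G \<in> U"
    then show "L G = (id(i := v 0)) (lam k G)" using cmp_le[of G] v_notin(2)
      by (cases "cmp G") (auto simp: L_def lam_def)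
  qed (use iW in auto)
  have "successive_separations (insert i W) i k v (SR_ideal K (insert i W) \<Delta>) (SR_ideal K (W \<union> X) ?\<Delta>')"
    unfolding successive_separations_def
  proof (intro exI[of _ J] conjI allI ballI impI)
    show "squarefree_monomial_ideal (insert i W \<union> v ` {1..j}) (J j)" if "j \<le> k" for j
      unfolding WZ J_def by (rule squarefree_face_ideal[OF splt_complex[OF lam[OF that]]])
  qed (rule J0 step last; assumption?)+
  moreover have "carrier (T1_homog (W \<union> X) (SR_ideal K (W \<union> X) ?\<Delta>') (- b)) =
      {\<zero>\<^bsub>T1_homog (W \<union> X) (SR_ideal K (W \<union> X) ?\<Delta>') (- b)\<^esub>}"
    if b: "\<forall>w. 0 \<le> Poly_Mapping.lookup b w" "Poly_Mapping.keys b \<subseteq> X" for b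
  proof -
    interpret J: stanley_reisner K "W \<union> X" ?\<Delta>' by unfold_locales (rule splt_complex[OF L])
    \<comment> \<open>Injectivity of \<open>v\<close> turns equal labels into equal components, so
      no new vertex carries two of them.\<close>
    have "cmp G = cmp G'" if "G \<in> U" "G' \<in> U" "L G = L G'" for G G'
      using that v_inj cmp_le by (simp add: L_def)
    then have "Hom_homog (W \<union> X) J.I (- b) \<subseteq> J.trivial"
      using b by (intro T1_splt_trivial[OF L]) (auto intro: cmp_const)
    then show ?thesis unfolding SR' using J.zero_in_Hom_homog by (intro J.T1_homog_trivialI) blast+
  qed
  ultimately show ?thesis
    unfolding V[symmetric] W_def[symmetric] X_def[symmetric] Let_def
    using splt_complex[OF L] by blast
qed

end
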